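(* There is an absolute constant $C>0$ such that for every $n\ge 1$ and every simple arrangement $\mathcal A$ of $n$ pseudolines in the Euclidean plane, there exists a dual path in $\mathcal A$ of length at least $\frac{1}{3}n^2 - Cn$. Moreover, there exist absolute constants $c_1,c_2>0$ such that every simple arrangement of $n$ pseudolines has at least $2^{c_1 n}$ distinct dual paths of length at least $c_2 n^2$ (i.e. exponentially many dual paths of length $\Omega(n^2)$).
   Context: A (Euclidean) pseudoline arrangement is a finite set of $x$-monotone curves in the plane (pseudolines) such that each pair of pseudolines crosses exactly once. It is simple if no three pseudolines pass through a common point. The pseudolines partition the plane into vertices (crossing points), edges (maximal pieces of pseudolines containing no vertex) and faces (connected components of the complement of the union of the pseudolines). A dual path is a sequence of faces such that any two consecutive faces share an edge and no face appears more than once; its length is the number of faces in the sequence. *)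

theory Defs
  imports "HOL-Analysis.Analysis"
begin

text \<open>
  A bi-infinite x-monotone curve is the graph of a continuous function on the whole real line.
  A pseudoline is represented by that function; distinct functions have distinct graphs, so sets
  of functions correspond to sets of curves.
\<close>

definition curve :: "(real \<Rightarrow> real) \<Rightarrow> (real \<times> real) set" where
  "curve f = {(x, f x) |x. True}"

text \<open>
  Crossing is more than meeting: the curves change sides at the common point.
\<close>

definition cross_at :: "(real \<Rightarrow> real) \<Rightarrow> (real \<Rightarrow> real) \<Rightarrow> real \<Rightarrow> bool" where
  "cross_at f g x \<longleftrightarrow> f x = g x \<and>
     (\<exists>e>0. \<forall>h. 0 < h \<and> h < e \<longrightarrow>
        (f (x - h) < g (x - h) \<and> g (x + h) < f (x + h)) \<or>
        (g (x - h) < f (x - h) \<and> f (x + h) < g (x + h)))"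

text \<open>
  As usual, that two pseudolines cross exactly once means that they have exactly one
  common point and cross there; touching elsewhere is not allowed.
\<close>

definition cross_exactly_once :: "(real \<Rightarrow> real) \<Rightarrow> (real \<Rightarrow> real) \<Rightarrow> bool" where
  "cross_exactly_once f g \<longleftrightarrow> (\<exists>!x. f x = g x) \<and> (\<exists>x. cross_at f g x)"

definition pseudoline_arrangement :: "(real \<Rightarrow> real) set \<Rightarrow> bool" where
  "pseudoline_arrangement A \<longleftrightarrow> finite A \<and> (\<forall>f\<in>A. continuous_on UNIV f) \<and>
     (\<forall>f\<in>A. \<forall>g\<in>A. f \<noteq> g \<longrightarrow> cross_exactly_once f g)"

definition simple_arrangement :: "(real \<Rightarrow> real) set \<Rightarrow> bool" where
  "simple_arrangement A \<longleftrightarrow> pseudoline_arrangement A \<and>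
     \<not> (\<exists>f\<in>A. \<exists>g\<in>A. \<exists>h\<in>A. f \<noteq> g \<and> f \<noteq> h \<and> g \<noteq> h \<and>
          curve f \<inter> curve g \<inter> curve h \<noteq> {})"

definition vertices :: "(real \<Rightarrow> real) set \<Rightarrow> (real \<times> real) set" where
  "vertices A = {p. \<exists>f\<in>A. \<exists>g\<in>A. f \<noteq> g \<and> p \<in> curve f \<inter> curve g}"

definition edges :: "(real \<Rightarrow> real) set \<Rightarrow> (real \<times> real) set set" where
  "edges A = (\<Union>f\<in>A. components (curve f - vertices A))"

definition faces :: "(real \<Rightarrow> real) set \<Rightarrow> (real \<times> real) set set" where
  "faces A = components (- (\<Union>f\<in>A. curve f))"

definition share_edge ::
    "(real \<Rightarrow> real) set \<Rightarrow> (real \<times> real) set \<Rightarrow> (real \<times> real) set \<Rightarrow> bool" where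
  "share_edge A F G \<longleftrightarrow> (\<exists>e\<in>edges A. e \<subseteq> frontier F \<and> e \<subseteq> frontier G)"

definition dual_path :: "(real \<Rightarrow> real) set \<Rightarrow> (real \<times> real) set list \<Rightarrow> bool" where
  "dual_path A P \<longleftrightarrow> P \<noteq> [] \<and> set P \<subseteq> faces A \<and> distinct P \<and>
     (\<forall>i. Suc i < length P \<longrightarrow> share_edge A (P ! i) (P ! Suc i))"

end

theory Submission
  imports Defs
begin

text \<open>
  A face is determined by the set \<open>D\<close> of pseudolines below it, and its level is \<open>card D\<close>. Crossing a pseudoline
  changes the level by one. For a corridor of three consecutive levels \<open>k - 1\<close>, \<open>k\<close>, \<open>k + 1\<close>, walk from left to
  right through all faces of level \<open>k\<close>. At a crossing \<open>b\<close> between two of them, step either through the face below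
  \<open>b\<close> or through the face above \<open>b\<close>: take the one below if its level has a crossing before the next crossing \<open>b'\<close>
  of level \<open>k\<close>, and the one above otherwise. As there are no digons, in the second case level \<open>k + 1\<close> has a crossing
  between \<open>b\<close> and \<open>b'\<close>, so no face is used twice. The length is about twice the number of crossings at level \<open>k\<close>. One
  of the three classes of levels modulo 3 contains a third of the \<open>n (n - 1) / 2\<close> crossings; the
  corridors around its levels are disjoint, and they are linked through unbounded faces, alternately on the right
  and on the left. To keep the unbounded face of entry free, each corridor gives up the crossings on the boundary of this
  face, which are \<open>O(n)\<close> in total. Skipping an arbitrary set of pairs of consecutive corridors gives exponentially many
  paths, half of which have at least half of the full length.
\<close>

subsection \<open>Levels and crossings\<close>


text \<open>The upper limits count the numbers in \<open>1..m\<close> congruent to 1, 2 and 0 modulo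
  3. Later \<open>m\<close> is \<open>card A - 1\<close> and \<open>k\<close> runs over the
  levels.\<close>

lemma sum_residues_mod_3:
  fixes v :: "nat \<Rightarrow> nat"
  shows "(\<Sum>k = 1..<Suc m. v k) = (\<Sum>i<(m + 2) div 3. v (Suc (3 * i))) +
    (\<Sum>i<(m + 1) div 3. v (Suc (1 + 3 * i))) + (\<Sum>i<m div 3. v (Suc (2 + 3 * i)))"
proof (induction m)
  case (Suc m)
  have "(\<exists>t. m = 3 * t) \<or> (\<exists>t. m = 3 * t + 1) \<or> (\<exists>t. m = 3 * t + 2)" by presburger
  moreover have "Suc (3 * t) div 3 = t" "Suc (Suc (3 * t)) div 3 = t" for t by presburger+
  ultimately show ?case using Suc by (elim disjE exE) simp_all
qed simp

text \<open>The curves are indexed through \<open>h\<close> so that the reflected arrangement keeps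
  the index set \<open>A\<close>, and the same sets \<open>D\<close> stand for its faces.\<close>

locale pseudolines =
  fixes A :: "'a set" and h :: "'a \<Rightarrow> real \<Rightarrow> real"
  assumes fin: "finite A"
    and cont: "f \<in> A \<Longrightarrow> continuous_on UNIV (h f)"
    and cross: "f \<in> A \<Longrightarrow> g \<in> A \<Longrightarrow> f \<noteq> g \<Longrightarrow> \<exists>c. h f c = h g c \<and>
      ((\<forall>x<c. h f x < h g x) \<and> (\<forall>x>c. h g x < h f x) \<or>
       (\<forall>x<c. h g x < h f x) \<and> (\<forall>x>c. h f x < h g x))"
    and simple: "f \<in> A \<Longrightarrow> g \<in> A \<Longrightarrow> l \<in> A \<Longrightarrow> f \<noteq> g \<Longrightarrow> f \<noteq> l \<Longrightarrow> g \<noteq> l \<Longrightarrow>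
      \<not> (h f x = h g x \<and> h g x = h l x)"
begin

text \<open>The vertical line at \<open>x\<close> passes through the face that has exactly
  \<open>D\<close> below it. Ties inside \<open>D\<close> or inside \<open>A - D\<close> are
  allowed, so such sets exist at abscissae of crossings too.\<close>

definition cut :: "real \<Rightarrow> 'a set \<Rightarrow> bool" where
  "cut x D \<longleftrightarrow> D \<subseteq> A \<and> (\<forall>f\<in>D. \<forall>g\<in>A - D. h f x < h g x)"

text \<open>Pitfall: \<open>crossings_at k\<close> is the whole line if \<open>k > card A\<close>.\<close>

definition crossings_at :: "nat \<Rightarrow> real set" where
  "crossings_at k = {x. \<not> (\<exists>D. cut x D \<and> card D = k)}"

definition crossings :: "real set" where
  "crossings = {x. \<exists>f\<in>A. \<exists>g\<in>A. f \<noteq> g \<and> h f x = h g x}"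

text \<open>After their single crossing two pseudolines never return to their former order, so
  \<open>x\<close> and \<open>y\<close> lie on the same side of it.\<close>

lemma less_between:
  assumes "f \<in> A" "g \<in> A" "h f x < h g x" "h f y < h g y" "x \<le> z" "z \<le> y"
  shows "h f z < h g z"
proof -
  have "f \<noteq> g" using assms by auto
  then obtain c where c: "h f c = h g c" and
      d: "(\<forall>x<c. h f x < h g x) \<and> (\<forall>x>c. h g x < h f x) \<or>
       (\<forall>x<c. h g x < h f x) \<and> (\<forall>x>c. h f x < h g x)"
    using cross[OF assms(1,2)] by blast
  from d show ?thesis
  proof
    assume d: "(\<forall>x<c. h f x < h g x) \<and> (\<forall>x>c. h g x < h f x)"
    then have "y < c" using assms(4) c by (metis less_asym less_irrefl linorder_neqE)
    then show ?thesis using d assms by auto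
  next
    assume d: "(\<forall>x<c. h g x < h f x) \<and> (\<forall>x>c. h f x < h g x)"
    then have "c < x" using assms(3) c by (metis less_asym less_irrefl linorder_neqE)
    then show ?thesis using d assms by auto
  qed
qed

lemma cross_unique:
  assumes "f \<in> A" "g \<in> A" "f \<noteq> g" "h f x = h g x" "h f y = h g y"
  shows "x = y"
  using cross[OF assms(1-3)] assms(4,5) by (metis less_irrefl linorder_neqE)

lemma finite_crossings: "finite crossings"
proof -
  have "crossings = (\<Union>f\<in>A. \<Union>g\<in>A - {f}. {x. h f x = h g x})"
  proof (intro set_eqI iffI)
    fix x assume "x \<in> crossings"
    then obtain f g where "f \<in> A" "g \<in> A" "f \<noteq> g" "h f x = h g x" unfolding crossings_def by blast
    then show "x \<in> (\<Union>f\<in>A. \<Union>g\<in>A - {f}. {x. h f x = h g x})" by auto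
  next
    fix x assume "x \<in> (\<Union>f\<in>A. \<Union>g\<in>A - {f}. {x. h f x = h g x})"
    then obtain f g where "f \<in> A" "g \<in> A" "f \<noteq> g" "h f x = h g x" by blast
    then show "x \<in> crossings" unfolding crossings_def by blast
  qed
  moreover have "finite {x. h f x = h g x}" if fg: "f \<in> A" "g \<in> A - {f}" for f g
  proof -
    obtain c where "h f c = h g c" using cross[of f g] fg by blast
    then have "{x. h f x = h g x} \<subseteq> {c}" using cross_unique[of f g _ c] fg by blast
    then show ?thesis by (rule finite_subset) simp
  qed
  ultimately show ?thesis using fin by simp
qed

text \<open>A face is met by an interval of vertical lines. A face that has ended thus never comes
  back, which later excludes repetitions.\<close>

lemma cut_between:
  assumes "cut x D" "cut y D" "x \<le> z" "z \<le> y"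
  shows "cut z D"
  unfolding cut_def
proof (intro conjI ballI)
  show "D \<subseteq> A" using assms(1) by (simp add: cut_def)
  fix f g assume "f \<in> D" "g \<in> A - D"
  then show "h f z < h g z"
    using assms less_between[of f g x y z] unfolding cut_def by blast
qed

lemma finite_cut: "cut x D \<Longrightarrow> finite D"
  unfolding cut_def using fin finite_subset by blast

text \<open>Cuts at one abscissa form a chain: \<open>f\<close> in \<open>D - E\<close> and
  \<open>g\<close> in \<open>E - D\<close> would each lie strictly below the other.\<close>

lemma cut_mono:
  assumes "cut x D" "cut x E" "card D \<le> card E"
  shows "D \<subseteq> E"
proof (rule ccontr)
  assume "\<not> D \<subseteq> E"
  then obtain f where f: "f \<in> D" "f \<notin> E" by auto
  have "E \<subseteq> D"
  proof (rule ccontr)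
    assume "\<not> E \<subseteq> D"
    then obtain g where "g \<in> E" "g \<notin> D" by auto
    then have "h f x < h g x" "h g x < h f x" using f assms(1,2) unfolding cut_def by auto
    then show False by simp
  qed
  then have "E \<subset> D" using f by auto
  then have "card E < card D" using finite_cut[OF assms(1)] by (rule psubset_card_mono[rotated])
  then show False using assms(3) by simp
qed

lemma cut_unique: "cut x D \<Longrightarrow> cut x E \<Longrightarrow> card D = card E \<Longrightarrow> D = E"
  by (intro subset_antisym cut_mono) simp_all

lemma cut_le: "cut x {f\<in>A. h f x \<le> y}" and cut_less: "cut x {f\<in>A. h f x < y}"
  unfolding cut_def by auto

lemma fibre_of_crossing:
  assumes "p \<in> A" "q \<in> A" "p \<noteq> q" "h p x = h q x"
  shows "{f\<in>A. h f x \<le> h p x} = {f\<in>A. h f x < h p x} \<union> {p, q}"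
proof -
  have "f = p \<or> f = q" if "f \<in> A" "h f x = h p x" for f
    using simple[of f p q x] that assms by metis
  then show ?thesis using assms by fastforce
qed

text \<open>Going upwards at \<open>x\<close>, the size of the cut grows by one, or by two where two
  pseudolines meet; simplicity excludes larger jumps. A missing size is therefore a
  crossing.\<close>

lemma crossings_at_iff:
  assumes "k \<le> card A"
  shows "x \<in> crossings_at k \<longleftrightarrow> (\<exists>p\<in>A. \<exists>q\<in>A. p \<noteq> q \<and> h p x = h q x \<and> Suc (card {f\<in>A. h f x < h p x}) = k)"
    (is "_ \<longleftrightarrow> ?R")
proof
  assume x: "x \<in> crossings_at k"
  \<comment> \<open>The largest cut of size at most \<open>k\<close> falls short of
    \<open>k\<close>; the lowest height above it then has to carry two pseudolines \<open>p\<close>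
    and \<open>q\<close>.\<close>
  let ?S = "{D. cut x D \<and> card D \<le> k}"
  have "?S \<subseteq> Pow A" by (auto simp: cut_def)
  then have fS: "finite ?S" using fin by (meson finite_Pow_iff finite_subset)
  have "{} \<in> ?S" by (simp add: cut_def)
  then have "Max (card ` ?S) \<in> card ` ?S" using fS by (intro Max_in) auto
  then obtain D where D: "D \<in> ?S" "Max (card ` ?S) = card D" by auto
  have max: "card E \<le> card D" if "E \<in> ?S" for E
    unfolding D(2)[symmetric] using fS that by (intro Max_ge) auto
  have cD: "cut x D" using D by simp
  have lt: "card D < k" using x D unfolding crossings_at_def by fastforce
  then have "D \<noteq> A" using assms by auto
  then have ne: "A - D \<noteq> {}" using cD unfolding cut_def by auto
  define y where "y = Min ((\<lambda>f. h f x) ` (A - D))"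
  have "y \<in> (\<lambda>f. h f x) ` (A - D)" unfolding y_def using fin ne by (intro Min_in) auto
  then obtain p where p: "p \<in> A - D" "y = h p x" by auto
  have le: "y \<le> h g x" if "g \<in> A - D" for g unfolding y_def using fin that by (intro Min_le) auto
  have eD: "{f\<in>A. h f x < h p x} = D"
    using cD p le unfolding cut_def by (auto simp: not_less[symmetric])
  define E where "E = {f\<in>A. h f x \<le> h p x}"
  have cE: "cut x E" unfolding E_def by (rule cut_le)
  have sub: "insert p D \<subseteq> E" unfolding E_def using eD p by auto
  then have c1: "Suc (card D) \<le> card E"
    using p card_mono[OF finite_cut[OF cE] sub] finite_cut[OF cD] by simp
  then have "\<not> card E \<le> k" using max[of E] cE by auto
  then have "k < card E" by simp
  then have "\<not> E \<subseteq> insert p D" using card_mono[of "insert p D" E] lt p finite_cut[OF cD] by auto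
  then obtain q where q: "q \<in> A" "h q x = h p x" "q \<noteq> p"
    unfolding E_def eD[symmetric] by force
  have "E = D \<union> {p, q}" using fibre_of_crossing[of p q x] p q eD unfolding E_def by auto
  then have "card E \<le> card D + 2" using card_Un_le[of D "{p,q}"] q(3) by simp
  then have "Suc (card D) = k" using \<open>k < card E\<close> lt by simp
  then show ?R using p q eD by (intro bexI[of _ p] bexI[of _ q]) auto
next
  assume ?R
  then obtain p q where pq: "p \<in> A" "q \<in> A" "p \<noteq> q" "h p x = h q x"
      and k: "Suc (card {f\<in>A. h f x < h p x}) = k" by auto
  let ?D = "{f\<in>A. h f x < h p x}"
  have fD: "finite ?D" using fin by simp
  show "x \<in> crossings_at k" unfolding crossings_at_def
  proof (clarify)
    fix D assume D: "cut x D" "k = card D"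
    \<comment> \<open>A cut of size \<open>k\<close> would lie between \<open>?D\<close> and
      \<open>?D\<close> with \<open>p\<close> and \<open>q\<close> added, so it would contain just
      one of the two; but a cut does not separate equal heights.\<close>
    have "?D \<subseteq> D" using cut_mono[OF cut_less D(1)] D k by simp
    moreover have "D \<subseteq> ?D \<union> {p, q}"
      unfolding fibre_of_crossing[OF pq, symmetric]
    proof (rule cut_mono[OF D(1) cut_le])
      have "card (?D \<union> {p, q}) = Suc k" using k pq fD by simp
      then show "card D \<le> card {f \<in> A. h f x \<le> h p x}"
        unfolding fibre_of_crossing[OF pq] using D(2) by simp
    qed
    moreover have "p \<in> D \<longleftrightarrow> q \<in> D"
    proof -
      have "\<not> h p x < h q x" "\<not> h q x < h p x" using pq(4) by simp_all
      then show ?thesis using D(1) pq(1,2) unfolding cut_def by blast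
    qed
    ultimately have "D = ?D \<or> D = insert p (insert q ?D)" by blast
    moreover have "card (insert p (insert q ?D)) = Suc k" using k pq fD by simp
    ultimately show False using D k by auto
  qed
qed

lemma crossings_at_subset: "k \<le> card A \<Longrightarrow> crossings_at k \<subseteq> crossings"
  unfolding crossings_def using crossings_at_iff by blast

lemma finite_crossings_at: "k \<le> card A \<Longrightarrow> finite (crossings_at k)"
  using crossings_at_subset finite_crossings finite_subset by blast

lemma crossings_at_bounds: "x \<in> crossings_at k \<Longrightarrow> k \<le> card A \<Longrightarrow> 0 < k \<and> k < card A"
proof -
  assume x: "x \<in> crossings_at k" and k: "k \<le> card A"
  have "cut x {}" "cut x A" by (auto simp: cut_def)
  then have "k \<noteq> 0" "k \<noteq> card A" using x unfolding crossings_at_def by auto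
  then show ?thesis using k by simp
qed

lemma crossings_atE:
  assumes "x \<in> crossings_at k" "k \<le> card A"
  obtains p q D where "p \<in> A" "q \<in> A" "p \<noteq> q" "h p x = h q x" "D = {f\<in>A. h f x < h p x}"
    "cut x D" "Suc (card D) = k" "p \<notin> D" "q \<notin> D" "cut x (insert p (insert q D))"
proof -
  obtain p q where pq: "p \<in> A" "q \<in> A" "p \<noteq> q" "h p x = h q x"
      and k: "Suc (card {f\<in>A. h f x < h p x}) = k" using assms crossings_at_iff by auto
  show ?thesis
    using that[OF pq refl cut_less k] cut_le[of x "h p x"] pq unfolding fibre_of_crossing[OF pq] by simp
qed

text \<open>The faces directly below and above the crossing are cuts at \<open>x\<close>, of sizes
  \<open>k - 1\<close> and \<open>k + 1\<close>.\<close>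

lemma crossings_at_adjacent:
  assumes "x \<in> crossings_at k" "k \<le> card A"
  shows "x \<notin> crossings_at (k - 1)" "x \<notin> crossings_at (Suc k)"
proof -
  obtain p q D where *: "p \<in> A" "q \<in> A" "p \<noteq> q" "h p x = h q x" "D = {f\<in>A. h f x < h p x}"
      "cut x D" "Suc (card D) = k" "p \<notin> D" "q \<notin> D" "cut x (insert p (insert q D))"
    by (rule crossings_atE[OF assms])
  have "card (insert p (insert q D)) = Suc k" "card D = k - 1"
    using *(3,7-9) finite_cut[OF *(6)] by simp_all
  then show "x \<notin> crossings_at (k - 1)" "x \<notin> crossings_at (Suc k)" using *(6,10) unfolding crossings_at_def by blast+
qed

lemma open_cut: "open {x. cut x D}"
proof (cases "D \<subseteq> A")
  case True
  have "{x. cut x D} = (\<Inter>f\<in>D. \<Inter>g\<in>A - D. {x. h f x < h g x})"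
    using True unfolding cut_def by auto
  moreover have "open {x. h f x < h g x}" if "f \<in> D" "g \<in> A - D" for f g
    using that True cont by (intro open_Collect_less) auto
  ultimately show ?thesis using fin True
    by (metis (no_types, lifting) finite_Diff finite_subset open_INT)
qed (simp add: cut_def)

text \<open>For varying \<open>D\<close> of size \<open>k\<close> the sets
  \<open>{x. cut x D}\<close> are open and disjoint and cover \<open>S\<close>, so a connected
  \<open>S\<close> lies in one of them.\<close>

lemma cut_connected:
  assumes S: "connected S" "S \<inter> crossings_at k = {}" and "x \<in> S" "z \<in> S" and D: "cut x D" "card D = k"
  shows "cut z D"
proof -
  let ?U = "{x. cut x D}" and ?W = "\<Union>E\<in>{E. card E = k \<and> E \<noteq> D}. {x. cut x E}"
  have "?U \<inter> ?W \<inter> S = {}" using cut_unique D by auto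
  moreover have "S \<subseteq> ?U \<union> ?W" using S(2) unfolding crossings_at_def by auto
  ultimately have "?U \<inter> S = {} \<or> ?W \<inter> S = {}"
    using open_cut by (intro connectedD[OF S(1)]) auto
  then have "?W \<inter> S = {}" using assms by auto
  then show ?thesis using \<open>S \<subseteq> ?U \<union> ?W\<close> assms(4) by blast
qed

text \<open>The face of level \<open>k\<close> over \<open>x\<close>. On
  \<open>crossings_at k\<close> there is none and the value is arbitrary.\<close>

definition lowest :: "nat \<Rightarrow> real \<Rightarrow> 'a set" where
  "lowest k x = (THE D. cut x D \<and> card D = k)"

lemma lowest_eqI: "cut x D \<Longrightarrow> card D = k \<Longrightarrow> lowest k x = D"
  unfolding lowest_def by (rule the_equality) (simp, rule cut_unique[of x], simp_all)

lemma lowest: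
  assumes "x \<notin> crossings_at k"
  shows "cut x (lowest k x)" "card (lowest k x) = k"
proof -
  obtain D where "cut x D" "card D = k" using assms unfolding crossings_at_def by blast
  then show "cut x (lowest k x)" "card (lowest k x) = k" using lowest_eqI by simp_all
qed

section \<open>Walks through neighbouring faces\<close>

definition adj :: "'a set \<Rightarrow> 'a set \<Rightarrow> bool" where
  "adj D E \<longleftrightarrow> (\<exists>x. cut x D \<and> cut x E \<and> (card E = Suc (card D) \<or> card D = Suc (card E)))"

text \<open>Dual paths in terms of the sets below the faces. In \<open>adj\<close> the common
  abscissa makes the two sets nested by \<open>cut_mono\<close>, hence one pseudoline apart. The
  empty list is a walk.\<close>

definition walk :: "'a set list \<Rightarrow> bool" where
  "walk P \<longleftrightarrow> distinct P \<and> (\<forall>D\<in>set P. \<exists>x. cut x D) \<and> successively adj P"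

lemma adj_sym: "adj D E \<Longrightarrow> adj E D"
  unfolding adj_def by blast

lemma walk_Cons:
  "walk (D # P) \<longleftrightarrow> (\<exists>x. cut x D) \<and> D \<notin> set P \<and> walk P \<and> (P = [] \<or> adj D (hd P))"
  unfolding walk_def by (cases P) auto

lemma walk_append:
  assumes "walk P" "walk Q" "set P \<inter> set Q = {}" "P = [] \<or> Q = [] \<or> adj (last P) (hd Q)"
  shows "walk (P @ Q)"
  using assms unfolding walk_def by (auto simp: successively_append_iff)

lemma cut_near_left:
  assumes "cut b D" "a < b"
  obtains x where "a < x" "x < b" "cut x D"
proof -
  have "b \<in> {x. cut x D}" using assms by simp
  then obtain e where "e > 0" "\<forall>y. dist y b < e \<longrightarrow> y \<in> {x. cut x D}"
    using open_cut[of D] unfolding open_dist by blast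
  then have e: "e > 0" "\<And>y. dist y b < e \<Longrightarrow> cut y D" by simp_all
  let ?x = "max (b - e/2) ((a + b) / 2)"
  show ?thesis
  proof (rule that[of ?x])
    show "cut ?x D" using e(1) assms(2) by (intro e(2)) (auto simp: dist_real_def max_def field_simps)
  qed (use e assms(2) in \<open>auto simp: max_def field_simps\<close>)
qed

text \<open>\<open>F\<close> holds the points not to be passed, such as the next crossing of a level
  or the right end \<open>hi\<close>.\<close>

lemma cut_near_right:
  assumes "cut b D" "finite F"
  obtains x where "b < x" "cut x D" "F \<inter> {b<..x} = {}"
proof -
  have "b \<in> {x. cut x D}" using assms by simp
  then obtain e where "e > 0" "\<forall>y. dist y b < e \<longrightarrow> y \<in> {x. cut x D}"
    using open_cut[of D] unfolding open_dist by blast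
  then have e: "e > 0" "\<And>y. dist y b < e \<Longrightarrow> cut y D" by simp_all
  obtain d where d: "d > 0" "\<And>z. z \<in> F \<Longrightarrow> z \<noteq> b \<Longrightarrow> d \<le> dist b z"
    using finite_set_avoid[OF assms(2), of b] by auto
  let ?x = "b + min e d / 2"
  show ?thesis
  proof (rule that[of ?x])
    show "cut ?x D" using e(1) d(1) by (intro e(2)) (auto simp: dist_real_def min_def)
    have False if "z \<in> F" "b < z" "z \<le> ?x" for z
      using d(2)[OF that(1)] that(2,3) d(1) by (auto simp: dist_real_def min_def field_simps split: if_splits)
    then show "F \<inter> {b<..?x} = {}" by auto
  qed (use e d in auto)
qed

text \<open>There are no digons: the same two pseudolines would meet at both crossings.\<close>

lemma no_digon:
  assumes "b \<in> crossings_at k" "b' \<in> crossings_at k" "b < b'" "k \<le> card A" "crossings_at k \<inter> {b<..<b'} = {}"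
  shows "crossings_at (k - 1) \<inter> {b<..<b'} \<noteq> {} \<or> crossings_at (Suc k) \<inter> {b<..<b'} \<noteq> {}"
proof (rule ccontr)
  assume "\<not> ?thesis"
  then have "crossings_at (k - 1) \<inter> {b<..<b'} = {}" "crossings_at (Suc k) \<inter> {b<..<b'} = {}" by auto
  moreover have "{b..b'} = insert b (insert b' {b<..<b'})" using assms(3) by auto
  ultimately have e: "{b..b'} \<inter> crossings_at (k - 1) = {}" "{b..b'} \<inter> crossings_at (Suc k) = {}"
    using crossings_at_adjacent assms(1,2,4) by auto
  obtain p q D where *: "p \<in> A" "q \<in> A" "p \<noteq> q" "h p b = h q b" "D = {f\<in>A. h f b < h p b}"
      "cut b D" "Suc (card D) = k" "p \<notin> D" "q \<notin> D" "cut b (insert p (insert q D))"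
    by (rule crossings_atE[OF assms(1,4)])
  obtain p' q' D' where **: "p' \<in> A" "q' \<in> A" "p' \<noteq> q'" "h p' b' = h q' b'"
      "D' = {f\<in>A. h f b' < h p' b'}"
      "cut b' D'" "Suc (card D') = k" "p' \<notin> D'" "q' \<notin> D'" "cut b' (insert p' (insert q' D'))"
    by (rule crossings_atE[OF assms(2,4)])
  have c: "card D = k - 1" "card D' = k - 1" "card (insert p (insert q D)) = Suc k"
      "card (insert p' (insert q' D')) = Suc k"
    using *(3,7-9) **(3,7-9) finite_cut[OF *(6)] finite_cut[OF **(6)] by simp_all
  have m: "b \<in> {b..b'}" "b' \<in> {b..b'}" using assms(3) by auto
  have D: "D = D'"
    using cut_unique[OF cut_connected[OF connected_Icc e(1) m *(6) c(1)] **(6)] c by simp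
  have "insert p (insert q D) = insert p' (insert q' D')"
    using cut_unique[OF cut_connected[OF connected_Icc e(2) m *(10) c(3)] **(10)] c by simp
  then have "{p, q} = {p', q'}" using D *(8,9) **(8,9) by blast
  then have "h p b' = h q b'" using **(4) by (auto simp: doubleton_eq_iff)
  then show False using cross_unique[OF *(1-4)] assms(3) by auto
qed

subsection \<open>Corridors\<close>

lemma adjI: "cut x D \<Longrightarrow> cut x E \<Longrightarrow> card E = Suc (card D) \<or> card D = Suc (card E) \<Longrightarrow> adj D E"
  unfolding adj_def by blast

text \<open>The face \<open>D\<close> of level \<open>k\<close> extends up to \<open>b\<close>, and
  the face \<open>E\<close> over \<open>b\<close> extends a little to its left, so some vertical
  line meets both.\<close>

lemma adj_before:
  assumes "x < b" "crossings_at k \<inter> {x..<b} = {}" "cut x D" "card D = k" "cut b E"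
    "card E = Suc k \<or> k = Suc (card E)"
  shows "adj D E"
proof -
  obtain y where y: "x < y" "y < b" "cut y E" by (rule cut_near_left[OF assms(5,1)])
  have "cut y D"
    by (rule cut_connected[of "{x..<b}" k x]) (use assms y in auto)
  then show ?thesis using y(3) assms(4,6) by (intro adjI) auto
qed

lemma adj_after:
  assumes "b < x" "crossings_at k \<inter> {b<..x} = {}" "cut x D" "card D = k" "cut b E"
    "card E = Suc k \<or> k = Suc (card E)"
  shows "adj D E"
proof -
  obtain y where y: "b < y" "cut y E" "{x} \<inter> {b<..y} = {}"
    by (rule cut_near_right[OF assms(5), of "{x}"]) simp_all
  have "cut y D"
    by (rule cut_connected[of "{b<..x}" k x]) (use assms y in auto)
  then show ?thesis using y(2) assms(4,6) by (intro adjI) auto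
qed

text \<open>Induction on the crossings of level \<open>k\<close> right of \<open>x0\<close>: each
  contributes a face of level \<open>k\<close> and a detour, and two more faces lead to the exit at
  \<open>hi\<close>. The last clause records over which points the faces of \<open>P\<close> lie; it
  shows that a prepended face is new.\<close>

lemma corridor_tail:
  assumes k: "0 < k" "k < card A" and hi: "\<forall>z\<in>crossings. z < hi"
  shows "x0 \<notin> crossings_at k \<Longrightarrow> x0 < hi \<Longrightarrow> card (crossings_at k \<inter> {x0<..}) = m \<Longrightarrow>
    \<exists>P. walk P \<and> P \<noteq> [] \<and> hd P = lowest k x0 \<and> last P = lowest (Suc k) hi \<and> length P = 2 * m + 2 \<and>
      (\<forall>D\<in>set P. (\<exists>x\<ge>x0. cut x D \<and> card D = k) \<or>
         (\<exists>x\<in>crossings_at k. x0 < x \<and> cut x D \<and> card D = k - 1) \<or>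
         (\<exists>x. (x \<in> crossings_at k \<and> x0 < x \<or> x = hi) \<and> cut x D \<and> card D = Suc k))"
proof (induction m arbitrary: x0)
  have hiV: "hi \<notin> crossings_at (Suc k)" "hi \<notin> crossings_at k" using crossings_at_subset[of k] crossings_at_subset[of "Suc k"] k hi by auto
  {
    case 0
    let ?D = "lowest k x0" and ?E = "lowest (Suc k) hi"
    have fV: "finite (crossings_at k \<inter> {x0<..})" using finite_crossings_at k by simp
    then have "crossings_at k \<inter> {x0<..} = {}" using 0 by simp
    moreover have "{x0..hi} \<subseteq> insert x0 {x0<..}" by auto
    ultimately have "{x0..hi} \<inter> crossings_at k = {}" using 0(1) by blast
    \<comment> \<open>With no crossing left, the face of level \<open>k\<close> reaches
      \<open>hi\<close>, and the exit lies directly above it.\<close>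
    then have c: "cut hi ?D"
      using cut_connected[OF connected_Icc, of x0 hi k x0 hi] lowest[OF 0(1)] 0(2) by auto
    then have "walk [?D, ?E]"
      using lowest[OF 0(1)] lowest[OF hiV(1)] adjI[OF c, of ?E] by (auto simp: walk_Cons walk_def)
    then show ?case using lowest[OF 0(1)] lowest[OF hiV(1)]
      by (intro exI[of _ "[?D, ?E]"]) auto
  next
    case (Suc m)
    let ?D = "lowest k x0"
    have fV: "finite (crossings_at k)" using finite_crossings_at k by simp
    define b where "b = Min (crossings_at k \<inter> {x0<..})"
    have ne: "crossings_at k \<inter> {x0<..} \<noteq> {}" using Suc.prems(3) by (metis card.empty nat.distinct(1))
    have b: "b \<in> crossings_at k" "x0 < b" using Min_in[OF _ ne] fV unfolding b_def by auto
    have bmin: "b \<le> x" if "x \<in> crossings_at k" "x0 < x" for x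
      unfolding b_def using that fV by (intro Min_le) auto
    have before: "crossings_at k \<inter> {x0..<b} = {}"
      using bmin Suc.prems(1) by (force simp: order_le_less)
    have "crossings_at k \<inter> {x0<..} = insert b (crossings_at k \<inter> {b<..})" using b bmin by (force simp: order_le_less)
    then have cm: "card (crossings_at k \<inter> {b<..}) = m" using Suc.prems(3) fV by simp
    have bhi: "b < hi" using b(1) crossings_at_subset[of k] k hi by auto
    \<comment> \<open>The detour \<open>X\<close> must avoid the places recorded for later faces of
      its level: the later crossings of level \<open>k\<close> and, for the upper choice, the exit
      at \<open>hi\<close>.\<close>
    obtain X where X: "cut b X" and Xc: "card X = k - 1 \<and> (\<forall>x\<in>crossings_at k. b < x \<longrightarrow> \<not> cut x X) \<or>
        card X = Suc k \<and> \<not> cut hi X \<and> (\<forall>x\<in>crossings_at k. b < x \<longrightarrow> \<not> cut x X)"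
    proof (cases "crossings_at k \<inter> {b<..} = {}")
      case True
      \<comment> \<open>After the last crossing of level \<open>k\<close> the detour goes below,
        because the face above may be the exit itself.\<close>
      then show ?thesis using that[of "lowest (k - 1) b"] lowest crossings_at_adjacent[OF b(1)] k by auto
    next
      case False
      define b' where "b' = Min (crossings_at k \<inter> {b<..})"
      have b': "b' \<in> crossings_at k" "b < b'" using Min_in[OF _ False] fV unfolding b'_def by auto
      have b'min: "b' \<le> x" if "x \<in> crossings_at k" "b < x" for x
        unfolding b'_def using that fV by (intro Min_le) auto
      \<comment> \<open>A face of level \<open>j\<close> over \<open>b\<close> does not extend to or
        beyond a later crossing of level \<open>j\<close>.\<close>
      have nc: "\<not> cut x (lowest j b)" if "z \<in> crossings_at j" "b < z" "z \<le> x" "b \<notin> crossings_at j" for x z j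
        using cut_between[of b "lowest j b" x z] lowest[OF that(4)] that unfolding crossings_at_def by fastforce
      have "crossings_at k \<inter> {b<..<b'} = {}" using b'min by force
      then consider z where "z \<in> crossings_at (k - 1)" "b < z" "z < b'" | z where "z \<in> crossings_at (Suc k)" "b < z" "z < b'"
        using no_digon[OF b(1) b'(1) b'(2)] k by fastforce
      then show ?thesis
      proof cases
        case 1
        have "\<not> cut x (lowest (k - 1) b)" if "x \<in> crossings_at k" "b < x" for x
          using nc[OF 1(1,2)] b'min[OF that] crossings_at_adjacent(1)[OF b(1)] k 1(3) by simp
        then show ?thesis using that[of "lowest (k - 1) b"] lowest[OF crossings_at_adjacent(1)[OF b(1)]] k by auto
      next
        case 2
        have n: "b \<notin> crossings_at (Suc k)" using crossings_at_adjacent(2)[OF b(1)] k by simp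
        have "\<not> cut x (lowest (Suc k) b)" if "x \<in> crossings_at k" "b < x" for x
          using nc[OF 2(1,2)] b'min[OF that] n 2(3) by simp
        moreover have "z < hi" using 2(1) crossings_at_subset[of "Suc k"] k hi by auto
        then have "\<not> cut hi (lowest (Suc k) b)" using nc[OF 2(1,2) _ n] by simp
        ultimately show ?thesis using that[of "lowest (Suc k) b"] lowest[OF n] by auto
      qed
    qed
    obtain x1 where x1: "b < x1" "cut x1 X" "(crossings_at k \<union> {hi}) \<inter> {b<..x1} = {}"
      by (rule cut_near_right[OF X, of "crossings_at k \<union> {hi}"]) (use fV in simp_all)
    have x1': "x1 < hi" "x1 \<notin> crossings_at k" using x1(1,3) bhi by auto
    have "crossings_at k \<inter> {x1<..} = crossings_at k \<inter> {b<..}" using x1 by force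
    then obtain P where P: "walk P" "P \<noteq> []" "hd P = lowest k x1" "last P = lowest (Suc k) hi"
        "length P = 2 * m + 2" and
      inv: "\<And>D. D \<in> set P \<Longrightarrow> (\<exists>x\<ge>x1. cut x D \<and> card D = k) \<or>
         (\<exists>x\<in>crossings_at k. x1 < x \<and> cut x D \<and> card D = k - 1) \<or>
         (\<exists>x. (x \<in> crossings_at k \<and> x1 < x \<or> x = hi) \<and> cut x D \<and> card D = Suc k)"
      using Suc.IH[of x1] x1' cm by auto
    have cD: "cut x0 ?D" "card ?D = k" using lowest[OF Suc.prems(1)] by auto
    have cX: "card X = Suc k \<or> k = Suc (card X)" using Xc k by auto
    have XV: "\<not> cut x X" if "x \<in> crossings_at k" "x1 < x" for x using Xc that x1(1) by auto
    have Xhi: "\<not> cut hi X" if "card X = Suc k" using Xc that by auto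
    have "X \<notin> set P"
    proof
      assume "X \<in> set P"
      from inv[OF this] show False
      proof (elim disjE)
        assume "\<exists>x\<ge>x1. cut x X \<and> card X = k"
        then show False using cX by auto
      next
        assume "\<exists>x\<in>crossings_at k. x1 < x \<and> cut x X \<and> card X = k - 1"
        then show False using XV by blast
      next
        assume "\<exists>x. (x \<in> crossings_at k \<and> x1 < x \<or> x = hi) \<and> cut x X \<and> card X = Suc k"
        then show False using XV Xhi by blast
      qed
    qed
    moreover have "adj X (hd P)"
      using adj_after[OF x1(1) _ _ _ X cX, of "lowest k x1"] x1(3) lowest[OF x1'(2)] P(3) adj_sym by auto
    ultimately have w: "walk (X # P)" using P(1) X walk_Cons by blast
    \<comment> \<open>Faces of level \<open>k\<close> in \<open>P\<close> lie over points from
      \<open>x1\<close> on. Were \<open>?D\<close> among them, it would extend over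
      \<open>b\<close>, a crossing of its own level.\<close>
    have "?D \<notin> set P"
    proof
      assume "?D \<in> set P"
      from inv[OF this] obtain x where x: "x1 \<le> x" "cut x ?D" using cD(2) k by auto
      then have "cut b ?D" using cut_between[OF cD(1) x(2), of b] b(2) x1(1) by simp
      then show False using b(1) cD(2) unfolding crossings_at_def by auto
    qed
    moreover have "?D \<noteq> X" using cX cD by auto
    moreover have "adj ?D X" using adj_before[OF b(2) before cD X cX] .
    ultimately have "walk (?D # X # P)" using w cD(1) by (subst walk_Cons) auto
    moreover have "(\<exists>x\<ge>x0. cut x D \<and> card D = k) \<or>
         (\<exists>x\<in>crossings_at k. x0 < x \<and> cut x D \<and> card D = k - 1) \<or>
         (\<exists>x. (x \<in> crossings_at k \<and> x0 < x \<or> x = hi) \<and> cut x D \<and> card D = Suc k)"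
      if "D \<in> set (?D # X # P)" for D
    proof -
      from that consider "D = ?D" | "D = X" | "D \<in> set P" by auto
      then show ?thesis
      proof cases
        case 1 then show ?thesis using cD by blast
      next
        case 2 then show ?thesis using Xc X b by blast
      next
        case 3
        have lt: "\<And>x. x1 \<le> x \<Longrightarrow> x0 \<le> x" "\<And>x. x1 < x \<Longrightarrow> x0 < x" using b(2) x1(1) by auto
        from inv[OF 3] show ?thesis using lt by blast
      qed
    qed
    ultimately show ?case using P
      by (intro exI[of _ "?D # X # P"]) simp
  }
qed

text \<open>The crossings of level \<open>k\<close> on the boundary of the leftmost face of level
  \<open>k - 1\<close>. If level \<open>k - 1\<close> has no crossing, as for \<open>k = 1\<close>,
  these are all crossings of level \<open>k\<close>.\<close>

definition early :: "nat \<Rightarrow> real set" where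
  "early k = {x \<in> crossings_at k. \<forall>z\<in>crossings_at (k - 1). x < z}"

lemma not_early: "x \<in> crossings_at k \<Longrightarrow> x \<notin> early k \<Longrightarrow> \<exists>z\<in>crossings_at (k - 1). z \<le> x"
  unfolding early_def by (auto simp: not_less)

text \<open>The entry face \<open>?L\<close> is put in front of a walk from
  \<open>corridor_tail\<close>. Starting that walk after the early crossings prevents
  \<open>?L\<close> from being a detour, at a cost of two faces per early crossing.\<close>

lemma corridor:
  assumes k: "0 < k" "k < card A" and lo: "\<forall>z\<in>crossings. lo < z" and hi: "\<forall>z\<in>crossings. z < hi" and "lo < hi"
  shows "\<exists>P. walk P \<and> P \<noteq> [] \<and> hd P = lowest (k - 1) lo \<and> last P = lowest (Suc k) hi \<and>
    2 * card (crossings_at k) \<le> length P + 2 * card (early k) \<and> (\<forall>D\<in>set P. k - 1 \<le> card D \<and> card D \<le> Suc k)"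
proof -
  let ?L = "lowest (k - 1) lo"
  have fV: "finite (crossings_at k)" using finite_crossings_at k by simp
  have fJ: "finite (early k)" and sJ: "early k \<subseteq> crossings_at k" using fV unfolding early_def by auto
  have loV: "lo \<notin> crossings_at j" if "j \<le> card A" for j using crossings_at_subset[OF that] lo by blast
  have L: "cut lo ?L" "card ?L = k - 1" using lowest[of lo "k - 1"] loV k by auto
  have Llater: "\<not> cut x ?L" if x: "x \<in> crossings_at k" "x \<notin> early k" for x
  proof
    assume c: "cut x ?L"
    obtain z where z: "z \<in> crossings_at (k - 1)" "z \<le> x" using not_early[OF x] by blast
    have "k - 1 \<le> card A" using k by simp
    then have "lo < z" using crossings_at_subset z(1) lo by blast
    then have "cut z ?L" using cut_between[OF L(1) c] z by simp
    then show False using z(1) L(2) unfolding crossings_at_def by blast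
  qed
  \<comment> \<open>The start is \<open>lo\<close> or a point just after the last early crossing,
    where \<open>?L\<close> still lies directly below the face of level \<open>k\<close>.\<close>
  obtain x0 where x0: "x0 \<notin> crossings_at k" "x0 < hi" "crossings_at k \<inter> {x0<..} = crossings_at k - early k" "cut x0 ?L"
  proof (cases "early k = {}")
    case True
    have "crossings_at k \<inter> {lo<..} = crossings_at k" using crossings_at_subset[of k] k lo by auto
    then show ?thesis using that[of lo] True loV k L assms(5) by simp
  next
    case False
    define b where "b = Max (early k)"
    have b: "b \<in> early k" unfolding b_def using fJ False by (rule Max_in)
    have bmax: "x \<le> b" if "x \<in> early k" for x unfolding b_def using fJ that by (rule Max_ge)
    have "b \<in> crossings" using b sJ crossings_at_subset[of k] k by auto
    then have lb: "lo < b" "b < hi" using lo hi by auto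
    have "{lo..b} \<inter> crossings_at (k - 1) = {}" using b unfolding early_def by auto
    then have c: "cut b ?L"
      using cut_connected[OF connected_Icc _ _ _ L, of lo b b] lb by simp
    obtain x0 where x0: "b < x0" "cut x0 ?L" "(crossings_at k \<union> {hi}) \<inter> {b<..x0} = {}"
      by (rule cut_near_right[OF c, of "crossings_at k \<union> {hi}"]) (use fV in simp_all)
    have "x0 < hi" "x0 \<notin> crossings_at k" using x0(1,3) lb by auto
    \<comment> \<open>A crossing that is not early has a crossing of level \<open>k - 1\<close> at
      or before it, and \<open>b\<close>, being early, precedes all of those.\<close>
    moreover have "crossings_at k \<inter> {x0<..} = crossings_at k - early k"
    proof -
      have "x0 < x" if x: "x \<in> crossings_at k" "x \<notin> early k" for x
      proof -
        obtain z where z: "z \<in> crossings_at (k - 1)" "z \<le> x" using not_early[OF x] by blast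
        then have "b < x" using b unfolding early_def by force
        then show ?thesis using x0(3) x(1) by (force simp: not_less[symmetric])
      qed
      moreover have "x \<notin> early k" if "x0 < x" for x using bmax[of x] that x0(1) by auto
      ultimately show ?thesis by auto
    qed
    ultimately show ?thesis using that x0(2) by blast
  qed
  have "card (crossings_at k - early k) = card (crossings_at k) - card (early k)" using card_Diff_subset[OF fJ sJ] .
  moreover have "card (early k) \<le> card (crossings_at k)" using card_mono[OF fV sJ] .
  ultimately obtain P where P: "walk P" "P \<noteq> []" "hd P = lowest k x0" "last P = lowest (Suc k) hi"
      "length P = 2 * (card (crossings_at k) - card (early k)) + 2" and
    inv: "\<And>D. D \<in> set P \<Longrightarrow> (\<exists>x\<ge>x0. cut x D \<and> card D = k) \<or>
       (\<exists>x\<in>crossings_at k. x0 < x \<and> cut x D \<and> card D = k - 1) \<or>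
       (\<exists>x. (x \<in> crossings_at k \<and> x0 < x \<or> x = hi) \<and> cut x D \<and> card D = Suc k)"
    using corridor_tail[OF k hi x0(1,2)] x0(3) by auto
  have "?L \<notin> set P"
  proof
    assume "?L \<in> set P"
    from inv[OF this] obtain x where "x \<in> crossings_at k" "x0 < x" "cut x ?L" using L(2) k by auto
    then show False using Llater x0(3) by blast
  qed
  moreover have "adj ?L (hd P)" using adjI[OF x0(4)] lowest[OF x0(1)] L(2) k P(3) by simp
  ultimately have "walk (?L # P)" using P(1) L(1) walk_Cons by blast
  moreover have "k - 1 \<le> card D \<and> card D \<le> Suc k" if "D \<in> set (?L # P)" for D
  proof (cases "D = ?L")
    case False
    then have "D \<in> set P" using that by simp
    from inv[OF this] show ?thesis by auto
  qed (use L(2) in simp)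
  ultimately show ?thesis using P by (intro exI[of _ "?L # P"]) simp
qed

text \<open>Send each pair of pseudolines to the level and abscissa of its crossing. These determine
  the cuts directly below and above the crossing, whose difference is the pair; so the map is
  injective.\<close>

lemma sum_crossings_at: "card A choose 2 \<le> (\<Sum>k = 1..<card A. card (crossings_at k))"
proof -
  let ?Q = "\<lambda>S k x. \<exists>p q. p \<in> A \<and> q \<in> A \<and> p \<noteq> q \<and> S = {p, q} \<and> h p x = h q x \<and>
     Suc (card {f\<in>A. h f x < h p x}) = k"
  let ?P = "{S. S \<subseteq> A \<and> card S = 2}" and ?S = "SIGMA k:{1..<card A}. crossings_at k"
  have "\<exists>kx. ?Q S (fst kx) (snd kx)" if "S \<in> ?P" for S
  proof -
    from that obtain p q where pq: "S = {p, q}" "p \<noteq> q" by (auto simp: card_2_iff)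
    then obtain x where "h p x = h q x" using cross[of p q] \<open>S \<in> ?P\<close> by blast
    then show ?thesis using pq \<open>S \<in> ?P\<close>
      by (intro exI[of _ "(Suc (card {f\<in>A. h f x < h p x}), x)"] exI[of _ p] exI[of _ q]) simp
  qed
  then have "\<forall>S\<in>?P. \<exists>kx. ?Q S (fst kx) (snd kx)" by (rule ballI)
  then obtain u where u': "\<forall>S\<in>?P. ?Q S (fst (u S)) (snd (u S))" by (rule bchoice[THEN exE])
  have u: "?Q S (fst (u S)) (snd (u S))" if "S \<in> ?P" for S using u' that by (rule bspec)
  have inj: "inj_on u ?P"
  proof (rule inj_onI)
    fix S S' assume S: "S \<in> ?P" "S' \<in> ?P" "u S = u S'"
    define k x where "k = fst (u S)" and "x = snd (u S)"
    obtain p q where pq: "p \<in> A" "q \<in> A" "p \<noteq> q" "h p x = h q x" "S = {p, q}"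
       and k: "Suc (card {f\<in>A. h f x < h p x}) = k"
      using u[OF S(1)] unfolding k_def x_def by auto
    obtain p' q' where pq': "p' \<in> A" "q' \<in> A" "p' \<noteq> q'" "h p' x = h q' x" "S' = {p', q'}"
       and k': "Suc (card {f\<in>A. h f x < h p' x}) = k"
      using u[OF S(2)] unfolding k_def x_def S(3) by auto
    let ?D = "{f\<in>A. h f x < h p x}" and ?D' = "{f\<in>A. h f x < h p' x}"
    have eq: "?D = ?D'" using k k' by (intro cut_unique[OF cut_less cut_less]) simp
    have "card (?D \<union> {p, q}) = card (?D' \<union> {p', q'})"
      using k k' fin pq pq' by simp
    then have "?D \<union> {p, q} = ?D' \<union> {p', q'}"
      using cut_unique[OF cut_le cut_le] unfolding fibre_of_crossing[OF pq(1-4), symmetric]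
         fibre_of_crossing[OF pq'(1-4), symmetric] by blast
    moreover have "?D \<inter> {p, q} = {}" "?D' \<inter> {p', q'} = {}" using pq(4) pq'(4) by auto
    ultimately show "S = S'" using eq pq(5) pq'(5) by blast
  qed
  have "u S \<in> ?S" if S: "S \<in> ?P" for S
  proof -
    obtain k x where kx: "u S = (k, x)" by fastforce
    obtain p q where pq: "p \<in> A" "q \<in> A" "p \<noteq> q" "h p x = h q x"
       and k: "Suc (card {f\<in>A. h f x < h p x}) = k"
      using u[OF S] unfolding kx by auto
    have "card {f\<in>A. h f x < h p x} < card A"
      using fin pq(1) by (intro psubset_card_mono) auto
    then have kA: "k \<le> card A" using k by simp
    then have x: "x \<in> crossings_at k" using crossings_at_iff[OF kA] pq k by blast
    then show ?thesis using crossings_at_bounds[OF x kA] kx by auto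
  qed
  then have "u ` ?P \<subseteq> ?S" by blast
  moreover have fS: "finite ?S" using finite_crossings_at by auto
  ultimately have "card ?P \<le> card ?S" using card_inj_on_le[OF inj] by blast
  moreover have "card ?S = (\<Sum>k = 1..<card A. card (crossings_at k))"
    using finite_crossings_at by (subst card_SigmaI) auto
  ultimately show ?thesis using n_subsets[OF fin, of 2] by simp
qed

text \<open>Charge a crossing in some \<open>early k\<close> to the pseudoline that leaves level \<open>k\<close> upwards there: it can be
  charged only once, since the other pseudoline stays below it from then on.\<close>

lemma sum_early: "(\<Sum>k = 1..<card A. card (early k)) \<le> card A"
proof -
  let ?Q = "\<lambda>p k x. p \<in> A \<and> Suc (card {f\<in>A. h f x < h p x}) = k \<and>
     (\<exists>q\<in>A. p \<noteq> q \<and> h p x = h q x \<and> (\<forall>y<x. h p y < h q y) \<and> (\<forall>y>x. h q y < h p y))"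
  let ?S = "SIGMA k:{1..<card A}. early k"
  have "\<exists>p. ?Q p (fst kx) (snd kx)" if "kx \<in> ?S" for kx
  proof -
    obtain k x where kx: "kx = (k, x)" by fastforce
    then have x: "x \<in> crossings_at k" "k \<le> card A" using that unfolding early_def by auto
    obtain p q where pq: "p \<in> A" "q \<in> A" "p \<noteq> q" "h p x = h q x"
       and k: "Suc (card {f\<in>A. h f x < h p x}) = k" using x crossings_at_iff by blast
    obtain c where c: "h p c = h q c" and
      d: "(\<forall>y<c. h p y < h q y) \<and> (\<forall>y>c. h q y < h p y) \<or>
       (\<forall>y<c. h q y < h p y) \<and> (\<forall>y>c. h p y < h q y)" using cross[OF pq(1-3)] by blast
    have "c = x" using cross_unique[OF pq(1-3) c pq(4)] .
    then have "?Q p k x \<or> ?Q q k x" using d pq k by auto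
    then show ?thesis using kx by auto
  qed
  then have "\<forall>kx\<in>?S. \<exists>p. ?Q p (fst kx) (snd kx)" by (rule ballI)
  then obtain u where u': "\<forall>kx\<in>?S. ?Q (u kx) (fst kx) (snd kx)" by (rule bchoice[THEN exE])
  have u: "?Q (u kx) (fst kx) (snd kx)" if "kx \<in> ?S" for kx using u' that by (rule bspec)
  \<comment> \<open>As \<open>x'\<close> is early, the set of pseudolines below \<open>p\<close> at
    \<open>x'\<close> is still a cut at \<open>x - 1\<close>. It contains \<open>q\<close>, which
    passed below \<open>p\<close> at \<open>x\<close>; but at \<open>x - 1\<close> the two are in
    the opposite order.\<close>
  have neq: False if t: "?Q p k x" "?Q p k' x'" "x' \<in> early k'" "k' \<le> card A" "x < x'" for p k k' x x'
  proof -
    let ?D = "{f\<in>A. h f x' < h p x'}"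
    obtain q where q: "q \<in> A" "\<forall>y<x. h p y < h q y" "\<forall>y>x. h q y < h p y" using t(1) by blast
    have "{x - 1..x'} \<inter> crossings_at (k' - 1) = {}" using t(3) unfolding early_def by auto
    moreover have "card ?D = k' - 1" using t(2) by auto
    ultimately have "cut (x - 1) ?D"
      using cut_connected[OF connected_Icc _ _ _ cut_less, of "x - 1" x' "k' - 1" x' "x - 1"] t(5) by simp
    moreover have "q \<in> ?D" "p \<in> A - ?D" using q(1,3) that(1,5) by auto
    ultimately have "h q (x - 1) < h p (x - 1)" unfolding cut_def by blast
    moreover have "h p (x - 1) < h q (x - 1)" using q(2) by simp
    ultimately show False by simp
  qed
  have "inj_on u ?S"
  proof (rule inj_onI)
    fix a b assume ab: "a \<in> ?S" "b \<in> ?S" "u a = u b"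
    obtain k x k' x' where e: "a = (k, x)" "b = (k', x')" by fastforce
    have q: "?Q (u a) k x" "?Q (u a) k' x'" using u[OF ab(1)] u[OF ab(2)] ab(3) e by auto
    have j: "x \<in> early k" "x' \<in> early k'" "k \<le> card A" "k' \<le> card A" using ab e by auto
    have "x = x'" using neq[OF q j(2,4)] neq[OF q(2,1) j(1,3)] by (cases x x' rule: linorder_cases) auto
    then show "a = b" using q e by auto
  qed
  moreover have "u ` ?S \<subseteq> A" using u by blast
  ultimately have "card ?S \<le> card A" using fin by (rule card_inj_on_le)
  moreover have "finite (early k)" if "k \<in> {1..<card A}" for k
    using finite_crossings_at[of k] that unfolding early_def by simp
  then have "card ?S = (\<Sum>k = 1..<card A. card (early k))" by (subst card_SigmaI) auto
  ultimately show ?thesis by simp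
qed

section \<open>Reflection: corridors from right to left\<close>

lemma mirror: "pseudolines A (\<lambda>f x. h f (- x))"
proof
  show "finite A" by (rule fin)
  show "continuous_on UNIV (\<lambda>x. h f (- x))" if "f \<in> A" for f
    by (rule continuous_on_compose2[OF cont[OF that]]) (auto intro: continuous_intros)
  show "\<exists>c. h f (- c) = h g (- c) \<and>
      ((\<forall>x<c. h f (- x) < h g (- x)) \<and> (\<forall>x>c. h g (- x) < h f (- x)) \<or>
       (\<forall>x<c. h g (- x) < h f (- x)) \<and> (\<forall>x>c. h f (- x) < h g (- x)))"
    if fg: "f \<in> A" "g \<in> A" "f \<noteq> g" for f g
  proof -
    obtain c where "h f c = h g c" "(\<forall>x<c. h f x < h g x) \<and> (\<forall>x>c. h g x < h f x) \<or>
       (\<forall>x<c. h g x < h f x) \<and> (\<forall>x>c. h f x < h g x)" using cross[OF fg] by blast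
    then show ?thesis by (intro exI[of _ "- c"]) auto
  qed
  show "\<not> (h f (- x) = h g (- x) \<and> h g (- x) = h l (- x))"
    if "f \<in> A" "g \<in> A" "l \<in> A" "f \<noteq> g" "f \<noteq> l" "g \<noteq> l" for f g l x
    using simple[OF that] .
qed

definition late :: "nat \<Rightarrow> real set" where
  "late k = {x \<in> crossings_at k. \<forall>z\<in>crossings_at (k - 1). z < x}"

context
begin

interpretation m: pseudolines A "\<lambda>f x. h f (- x)" by (rule mirror)

lemma mirror_cut: "m.cut x D \<longleftrightarrow> cut (- x) D"
  unfolding m.cut_def cut_def ..

lemma mirror_crossings_at: "m.crossings_at k = uminus ` crossings_at k"
proof (intro set_eqI iffI)
  fix x assume "x \<in> m.crossings_at k"
  then have "- x \<in> crossings_at k" unfolding m.crossings_at_def crossings_at_def mirror_cut by simp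
  then show "x \<in> uminus ` crossings_at k" by (metis image_eqI minus_minus)
next
  fix x assume "x \<in> uminus ` crossings_at k"
  then show "x \<in> m.crossings_at k" unfolding m.crossings_at_def crossings_at_def mirror_cut by auto
qed

lemma mirror_early: "m.early k = uminus ` late k"
  unfolding m.early_def late_def mirror_crossings_at by auto

lemma mirror_card: "card (m.crossings_at k) = card (crossings_at k)" "card (m.early k) = card (late k)"
  unfolding mirror_crossings_at mirror_early by (auto intro: card_image simp: inj_on_def)

lemma mirror_lowest: "m.lowest k x = lowest k (- x)"
  unfolding m.lowest_def lowest_def mirror_cut ..

lemma mirror_adj: "m.adj D E \<longleftrightarrow> adj D E"
  unfolding m.adj_def adj_def mirror_cut by (metis minus_minus)

lemma mirror_walk: "m.walk P \<longleftrightarrow> walk P"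
proof -
  have "m.adj = adj" using mirror_adj by blast
  moreover have "(\<exists>x. m.cut x D) \<longleftrightarrow> (\<exists>x. cut x D)" for D
    unfolding mirror_cut by (metis minus_minus)
  ultimately show ?thesis unfolding m.walk_def walk_def by simp
qed

lemma mirror_crossings: "x \<in> m.crossings \<longleftrightarrow> - x \<in> crossings"
  unfolding m.crossings_def crossings_def by simp

lemma sum_late: "(\<Sum>k = 1..<card A. card (late k)) \<le> card A"
  using m.sum_early unfolding mirror_card .

text \<open>This is \<open>corridor\<close> for the reflection, whose ends are \<open>- hi\<close>
  and \<open>- lo\<close>: entry on the right, exit on the left, and \<open>late\<close> in place of
  \<open>early\<close>.\<close>

lemma corridor_reversed:
  assumes k: "0 < k" "k < card A" and lo: "\<forall>z\<in>crossings. lo < z" and hi: "\<forall>z\<in>crossings. z < hi" and "lo < hi"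
  shows "\<exists>P. walk P \<and> P \<noteq> [] \<and> hd P = lowest (k - 1) hi \<and> last P = lowest (Suc k) lo \<and>
    2 * card (crossings_at k) \<le> length P + 2 * card (late k) \<and> (\<forall>D\<in>set P. k - 1 \<le> card D \<and> card D \<le> Suc k)"
proof -
  have "lo < - z" "- z < hi" if "z \<in> m.crossings" for z using that lo hi by (simp_all add: mirror_crossings)
  then have "\<forall>z\<in>m.crossings. - hi < z" "\<forall>z\<in>m.crossings. z < - lo" by (force simp: minus_less_iff less_minus_iff)+
  then show ?thesis
    using m.corridor[OF k, of "- hi" "- lo"] assms(5)
    unfolding mirror_card mirror_walk mirror_lowest by simp
qed

end

text \<open>A pseudoline in the set and one outside it cross between \<open>lo\<close> and
  \<open>hi\<close>, so the set is not a cut at both ends. This tells a right exit from the faces of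
  a skipped corridor.\<close>

lemma lowest_ends_differ:
  assumes "\<forall>z\<in>crossings. lo < z" "\<forall>z\<in>crossings. z < hi" "0 < j" "j < card A"
  shows "lowest j lo \<noteq> lowest j hi"
proof
  let ?D = "lowest j lo"
  assume eq: "?D = lowest j hi"
  have "lo \<notin> crossings_at j" "hi \<notin> crossings_at j" using crossings_at_subset[of j] assms by auto
  then have D: "cut lo ?D" "cut hi ?D" "card ?D = j" using lowest[of lo j] lowest[of hi j] eq by auto
  have "?D \<noteq> {}" "?D \<noteq> A" using D(3) assms(3,4) by auto
  moreover have "?D \<subseteq> A" using D(1) unfolding cut_def by blast
  ultimately obtain f g where fg: "f \<in> ?D" "g \<in> A - ?D" "f \<in> A" by blast
  then have "f \<noteq> g" by blast
  then obtain c where c: "h f c = h g c" using cross[of f g] fg by blast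
  then have "c \<in> crossings" using fg \<open>f \<noteq> g\<close> unfolding crossings_def by blast
  then have "lo < c" "c < hi" using assms(1,2) by blast+
  then have "cut c ?D" using cut_between[OF D(1,2)] by simp
  then show False using fg(1,2) c unfolding cut_def by force
qed

subsection \<open>Linking the corridors\<close>

text \<open>Segments in disjoint bands of levels share no face; the induction carries the bound on
  \<open>card D\<close> to see this.\<close>

lemma walk_concat:
  assumes "\<And>i. i < Q \<Longrightarrow> walk (seg i) \<and> seg i \<noteq> [] \<and>
      (\<forall>D\<in>set (seg i). r + 3 * i \<le> card D \<and> card D \<le> r + 3 * i + 2)"
    and "\<And>i. Suc i < Q \<Longrightarrow> adj (last (seg i)) (hd (seg (Suc i)))"
  shows "walk (concat (map seg [0..<Q])) \<and> (\<forall>D\<in>set (concat (map seg [0..<Q])). card D < r + 3 * Q)"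
  using assms
proof (induction Q)
  case 0
  then show ?case by (simp add: walk_def)
next
  case (Suc Q)
  let ?P = "concat (map seg [0..<Q])"
  have P: "walk ?P" "\<forall>D\<in>set ?P. card D < r + 3 * Q" using Suc.IH Suc.prems by auto
  have Q: "walk (seg Q)" "seg Q \<noteq> []" "\<forall>D\<in>set (seg Q). r + 3 * Q \<le> card D \<and> card D \<le> r + 3 * Q + 2"
    using Suc.prems(1)[of Q] by auto
  have "?P = [] \<or> adj (last ?P) (hd (seg Q))"
  proof (cases Q)
    case (Suc i)
    then have "seg i \<noteq> []" using Suc.prems(1)[of i] by simp
    then have "last ?P = last (seg i)" using Suc by simp
    then show ?thesis using Suc.prems(2)[of i] Suc by simp
  qed simp
  moreover have "set ?P \<inter> set (seg Q) = {}" using P(2) Q(3) by (meson disjoint_iff not_le)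
  ultimately have "walk (?P @ seg Q)" using P(1) Q(1) walk_append by blast
  moreover have "card D < r + 3 * Suc Q" if "D \<in> set (?P @ seg Q)" for D
  proof -
    from that consider "D \<in> set ?P" | "D \<in> set (seg Q)" by auto
    then show ?thesis using P(2) Q(3) by cases fastforce+
  qed
  ultimately show ?case by simp
qed

text \<open>Corridor \<open>i\<close> consists of the levels from \<open>r + 3 * i\<close> to \<open>r + 3 * i + 2\<close>. Even corridors are traversed from left
  to right and odd ones from right to left; \<open>S\<close> is the set of those pairs of consecutive corridors that are
  skipped along their leftmost faces.\<close>

lemma walks_skipping:
  assumes Q: "\<And>i. i < Q \<Longrightarrow> Suc (r + 3 * i) < card A"
  shows "\<exists>W l. (\<forall>i<Q. 2 * card (crossings_at (Suc (r + 3 * i))) \<le>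
        l i + 2 * (card (early (Suc (r + 3 * i))) + card (late (Suc (r + 3 * i))))) \<and>
      (\<forall>S. walk (W S) \<and> (\<Sum>i\<in>{i. i < Q \<and> i div 2 \<notin> S}. l i) \<le> length (W S)) \<and>
      inj_on W (Pow {..<Q div 2})"
proof -
  obtain B where B: "\<forall>z\<in>crossings. \<bar>z\<bar> \<le> B"
    using finite_imp_bounded[OF finite_crossings] unfolding bounded_real by blast
  \<comment> \<open>The faces over \<open>lo\<close> and \<open>hi\<close> are unbounded to the left
    and right. Taking \<open>\<bar>B\<bar>\<close> gives \<open>lo < hi\<close> even without
    crossings.\<close>
  define lo hi where "lo = - \<bar>B\<bar> - 1" and "hi = \<bar>B\<bar> + 1"
  have lo: "\<forall>z\<in>crossings. lo < z" and hi: "\<forall>z\<in>crossings. z < hi" and lohi: "lo < hi"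
    using B unfolding lo_def hi_def by force+
  have nV: "lo \<notin> crossings_at j" "hi \<notin> crossings_at j" if "j \<le> card A" for j using crossings_at_subset[OF that] lo hi by auto
  let ?k = "\<lambda>i. Suc (r + 3 * i)"
  let ?C = "\<lambda>i P. walk P \<and> P \<noteq> [] \<and> (even i \<longrightarrow> hd P = lowest (r + 3 * i) lo \<and> last P = lowest (Suc (?k i)) hi) \<and>
     (odd i \<longrightarrow> hd P = lowest (r + 3 * i) hi \<and> last P = lowest (Suc (?k i)) lo) \<and>
     2 * card (crossings_at (?k i)) \<le> length P + 2 * (card (early (?k i)) + card (late (?k i))) \<and>
     (\<forall>D\<in>set P. r + 3 * i \<le> card D \<and> card D \<le> r + 3 * i + 2)"
  have "\<exists>P. ?C i P" if i: "i < Q" for i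
  proof (cases "even i")
    case True
    obtain P where "walk P \<and> P \<noteq> [] \<and> hd P = lowest (?k i - 1) lo \<and> last P = lowest (Suc (?k i)) hi \<and>
    2 * card (crossings_at (?k i)) \<le> length P + 2 * card (early (?k i)) \<and> (\<forall>D\<in>set P. ?k i - 1 \<le> card D \<and> card D \<le> Suc (?k i))"
      using corridor[OF _ Q[OF i] lo hi lohi] by blast
    then show ?thesis using True by (intro exI[of _ P]) simp
  next
    case False
    obtain P where "walk P \<and> P \<noteq> [] \<and> hd P = lowest (?k i - 1) hi \<and> last P = lowest (Suc (?k i)) lo \<and>
    2 * card (crossings_at (?k i)) \<le> length P + 2 * card (late (?k i)) \<and> (\<forall>D\<in>set P. ?k i - 1 \<le> card D \<and> card D \<le> Suc (?k i))"
      using corridor_reversed[OF _ Q[OF i] lo hi lohi] by blast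
    then show ?thesis using False by (intro exI[of _ P]) simp
  qed
  then have "\<forall>i\<in>{..<Q}. \<exists>P. ?C i P" by simp
  then obtain R where "\<forall>i\<in>{..<Q}. ?C i (R i)" by (rule bchoice[THEN exE])
  then have R: "?C i (R i)" if "i < Q" for i using that by simp
  \<comment> \<open>A skipped corridor is climbed straight up at \<open>lo\<close>. A pair is
    entered and left at \<open>lo\<close> whether it is skipped or traversed, so the choices are
    independent.\<close>
  define seg where "seg S i = (if i div 2 \<in> S
      then [lowest (r + 3 * i) lo, lowest (?k i) lo, lowest (Suc (?k i)) lo] else R i)" for S i
  have seg: "walk (seg S i) \<and> seg S i \<noteq> [] \<and>
      (\<forall>D\<in>set (seg S i). r + 3 * i \<le> card D \<and> card D \<le> r + 3 * i + 2)"
    and ends: "hd (seg S i) = lowest (r + 3 * i) (if odd i \<and> i div 2 \<notin> S then hi else lo)"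
      "last (seg S i) = lowest (Suc (?k i)) (if even i \<and> i div 2 \<notin> S then hi else lo)"
    if i: "i < Q" for S i
  proof -
    let ?a = "lowest (r + 3 * i) lo" and ?b = "lowest (?k i) lo" and ?c = "lowest (Suc (?k i)) lo"
    have c: "cut lo ?a" "card ?a = r + 3 * i" "cut lo ?b" "card ?b = ?k i" "cut lo ?c" "card ?c = Suc (?k i)"
      using lowest[OF nV(1)] Q[OF i] by simp_all
    have "adj ?a ?b" "adj ?b ?c" using c by (auto intro: adjI[of lo])
    moreover have "?a \<noteq> ?b" "?a \<noteq> ?c" "?b \<noteq> ?c" using c(2,4,6) by auto
    ultimately have "walk [?a, ?b, ?c]" using c(1,3,5) unfolding walk_def by auto
    moreover have "\<forall>D\<in>set [?a, ?b, ?c]. r + 3 * i \<le> card D \<and> card D \<le> r + 3 * i + 2"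
      using c(2,4,6) by simp
    ultimately have "walk [?a, ?b, ?c] \<and> (\<forall>D\<in>set [?a, ?b, ?c]. r + 3 * i \<le> card D \<and> card D \<le> r + 3 * i + 2)" ..
    then show "walk (seg S i) \<and> seg S i \<noteq> [] \<and>
      (\<forall>D\<in>set (seg S i). r + 3 * i \<le> card D \<and> card D \<le> r + 3 * i + 2)"
      using R[OF i] unfolding seg_def by simp
    show "hd (seg S i) = lowest (r + 3 * i) (if odd i \<and> i div 2 \<notin> S then hi else lo)"
      "last (seg S i) = lowest (Suc (?k i)) (if even i \<and> i div 2 \<notin> S then hi else lo)"
      using R[OF i] unfolding seg_def by auto
  qed
  have link: "adj (last (seg S i)) (hd (seg S (Suc i)))" if i: "Suc i < Q" for S i
  proof -
    \<comment> \<open>The side on which corridor \<open>i\<close> is left. Within a pair both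
      corridors agree on skipping; between pairs the side is always \<open>lo\<close>.\<close>
    let ?e = "if even i \<and> i div 2 \<notin> S then hi else lo"
    have e: "?e = (if odd (Suc i) \<and> Suc i div 2 \<notin> S then hi else lo)" by auto
    have "r + 3 * Suc i = Suc (Suc (?k i))" by simp
    moreover have "?e \<notin> crossings_at j" if "j \<le> card A" for j using nV[OF that] by simp
    moreover have "Suc (Suc (?k i)) \<le> card A" using Q[OF i] by simp
    ultimately show ?thesis
      using i unfolding ends(2)[OF Suc_lessD[OF i]] ends(1)[OF i] e[symmetric]
      by (intro adjI[of ?e]) (simp_all add: lowest)
  qed
  define W where "W S = concat (map (seg S) [0..<Q])" for S
  have walk: "walk (W S)" for S
    using walk_concat[of Q "seg S" r] seg link unfolding W_def by blast
  have len: "(\<Sum>i\<in>{i. i < Q \<and> i div 2 \<notin> S}. length (R i)) \<le> length (W S)" for S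
  proof -
    have "(\<Sum>i\<in>{i. i < Q \<and> i div 2 \<notin> S}. length (R i)) = (\<Sum>i\<in>{i. i < Q \<and> i div 2 \<notin> S}. length (seg S i))"
      by (intro sum.cong) (auto simp: seg_def)
    also have "\<dots> \<le> (\<Sum>i<Q. length (seg S i))" by (intro sum_mono2) auto
    also have "\<dots> = length (W S)"
      unfolding W_def length_concat by (simp add: comp_def interv_sum_list_conv_sum_set_nat lessThan_atLeast0)
    finally show ?thesis .
  qed
  \<comment> \<open>The right exit of corridor \<open>2 * p\<close> is visited exactly if pair
    \<open>p\<close> is traversed, so \<open>S\<close> can be read off from
    \<open>W S\<close>.\<close>
  have mem: "lowest (Suc (?k (2 * p))) hi \<in> set (W S) \<longleftrightarrow> p \<notin> S" if p: "p < Q div 2" for p S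
  proof
    let ?D = "lowest (Suc (?k (2 * p))) hi"
    have pQ: "Suc (2 * p) < Q" using p by linarith
    have "Suc (?k (2 * p)) < card A" using Q[OF pQ] by simp
    then have D: "card ?D = Suc (?k (2 * p))" "?D \<noteq> lowest (Suc (?k (2 * p))) lo"
      using lowest(2)[OF nV(2)] lowest_ends_differ[OF lo hi, of "Suc (?k (2 * p))"] by simp_all
    {
      assume "?D \<in> set (W S)"
      then obtain i where i: "i < Q" "?D \<in> set (seg S i)" unfolding W_def by auto
      then have "r + 3 * i \<le> Suc (?k (2 * p))" "Suc (?k (2 * p)) \<le> r + 3 * i + 2"
        using seg[OF i(1), of S] D(1) by auto
      then have i2: "i = 2 * p" by presburger
      show "p \<notin> S"
      proof
        assume "p \<in> S"
        then have "?D \<in> set (map (\<lambda>j. lowest j lo) [r + 3 * i, ?k i, Suc (?k i)])"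
          using i(2) i2 unfolding seg_def by simp
        then obtain j where j: "j \<in> set [r + 3 * i, ?k i, Suc (?k i)]" "?D = lowest j lo"
          by (simp only: set_map) blast
        then have "j \<le> card A" using Q[OF i(1)] by auto
        then have "card ?D = j" using lowest(2)[OF nV(1)] j(2) by simp
        then show False using D j(2) by simp
      qed
    next
      assume "p \<notin> S"
      then have "?D = last (seg S (2 * p))" using ends(2)[of "2 * p" S] pQ by simp
      then have "?D \<in> set (seg S (2 * p))" using seg[of "2 * p" S] pQ by simp
      then show "?D \<in> set (W S)" unfolding W_def using pQ by auto
    }
  qed
  have "inj_on W (Pow {..<Q div 2})"
  proof (rule inj_onI)
    fix S T assume "S \<in> Pow {..<Q div 2}" "T \<in> Pow {..<Q div 2}" "W S = W T"
    then show "S = T" using mem[of _ S] mem[of _ T] by (metis PowD lessThan_iff subset_antisym subsetD subsetI)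
  qed
  then show ?thesis using R walk len by (intro exI[of _ W] exI[of _ "\<lambda>i. length (R i)"]) simp
qed

text \<open>The best residue class has a third of the crossings, each worth two faces. The losses
  are two faces for each of at most \<open>2 * card A\<close> early or late crossings, which the
  factor 3 turns into \<open>12 * card A\<close>.\<close>

lemma many_corridors:
  assumes "0 < card A"
  shows "\<exists>Q W l. card A \<le> 3 * Q + 3 \<and> card A * (card A - 1) \<le> 3 * (\<Sum>i<Q. l i) + 12 * card A \<and>
      (\<forall>S. walk (W S) \<and> (\<Sum>i\<in>{i. i < Q \<and> i div 2 \<notin> S}. l i) \<le> length (W S)) \<and>
      inj_on W (Pow {..<Q div 2})"
proof -
  obtain m where m: "card A = Suc m" using assms gr0_implies_Suc by blast
  let ?T = "\<lambda>r. \<Sum>i<(m + 2 - r) div 3. card (crossings_at (Suc (r + 3 * i)))"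
  have "even (card A * (card A - 1))" unfolding m by simp
  then have "card A * (card A - 1) = 2 * (card A choose 2)"
    unfolding choose_two by (rule dvd_mult_div_cancel[symmetric])
  also have "\<dots> \<le> 2 * (\<Sum>k = 1..<card A. card (crossings_at k))" using sum_crossings_at by (rule mult_le_mono2)
  also have "(\<Sum>k = 1..<card A. card (crossings_at k)) = ?T 0 + ?T 1 + ?T 2"
    using sum_residues_mod_3[of "\<lambda>k. card (crossings_at k)" m] unfolding m by (simp add: ac_simps)
  finally have T: "card A * (card A - 1) \<le> 2 * (?T 0 + ?T 1 + ?T 2)" .
  have "N \<le> 2 * (a + b + c) \<Longrightarrow> N \<le> 6 * a \<or> N \<le> 6 * b \<or> N \<le> 6 * c" for N a b c :: nat by arith
  from this[OF T] have "card A * (card A - 1) \<le> 6 * ?T 0 \<or> card A * (card A - 1) \<le> 6 * ?T 1 \<or>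
      card A * (card A - 1) \<le> 6 * ?T 2" .
  then obtain r where r: "r \<le> 2" "card A * (card A - 1) \<le> 6 * ?T r"
    by (metis le_refl one_le_numeral zero_le)
  define Q where "Q = (m + 2 - r) div 3"
  have Q: "Suc (r + 3 * i) < card A" if "i < Q" for i using that r(1) unfolding Q_def m by linarith
  obtain W l where l: "\<forall>i<Q. 2 * card (crossings_at (Suc (r + 3 * i))) \<le>
        l i + 2 * (card (early (Suc (r + 3 * i))) + card (late (Suc (r + 3 * i))))"
    and W: "\<forall>S. walk (W S) \<and> (\<Sum>i\<in>{i. i < Q \<and> i div 2 \<notin> S}. l i) \<le> length (W S)"
      "inj_on W (Pow {..<Q div 2})"
    using walks_skipping[of Q r, OF Q] by blast
  have sub: "(\<Sum>i<Q. f (Suc (r + 3 * i))) \<le> (\<Sum>k = 1..<card A. f k)" for f :: "nat \<Rightarrow> nat"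
  proof -
    have "(\<Sum>i<Q. f (Suc (r + 3 * i))) = sum f ((\<lambda>i. Suc (r + 3 * i)) ` {..<Q})"
      by (subst sum.reindex) (auto simp: inj_on_def)
    also have "\<dots> \<le> (\<Sum>k = 1..<card A. f k)" using Q by (intro sum_mono2) auto
    finally show ?thesis .
  qed
  have "2 * ?T r = (\<Sum>i<Q. 2 * card (crossings_at (Suc (r + 3 * i))))" unfolding Q_def by (rule sum_distrib_left)
  also have "\<dots> \<le> (\<Sum>i<Q. l i + 2 * (card (early (Suc (r + 3 * i))) + card (late (Suc (r + 3 * i)))))"
    using l by (intro sum_mono) auto
  also have "\<dots> = (\<Sum>i<Q. l i) + 2 * ((\<Sum>i<Q. card (early (Suc (r + 3 * i)))) + (\<Sum>i<Q. card (late (Suc (r + 3 * i)))))"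
    by (simp add: sum.distrib sum_distrib_left)
  also have "\<dots> \<le> (\<Sum>i<Q. l i) + 2 * (card A + card A)"
    using sub[of "\<lambda>k. card (early k)"] sub[of "\<lambda>k. card (late k)"] sum_early sum_late by simp
  finally have "2 * ?T r \<le> (\<Sum>i<Q. l i) + 2 * (card A + card A)" .
  moreover have "N \<le> 6 * t \<Longrightarrow> 2 * t \<le> s + 2 * (a + a) \<Longrightarrow> N \<le> 3 * s + 12 * a" for N t s a :: nat
    by presburger
  ultimately have "card A * (card A - 1) \<le> 3 * (\<Sum>i<Q. l i) + 12 * card A" using r(2) by blast
  moreover have "card A \<le> 3 * Q + 3" unfolding Q_def m using r(1) by linarith
  ultimately show ?thesis using W by blast
qed

section \<open>Long walks and their number\<close>

lemma long_walk:
  assumes "0 < card A"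
  shows "\<exists>P. walk P \<and> 1 / 3 * (real (card A))\<^sup>2 - 5 * real (card A) \<le> real (length P)"
proof -
  let ?n = "card A"
  obtain Q :: nat and W l where l: "?n * (?n - 1) \<le> 3 * (\<Sum>i<Q. l i) + 12 * ?n"
    and W: "\<forall>S. walk (W S) \<and> (\<Sum>i\<in>{i. i < Q \<and> i div 2 \<notin> S}. l i) \<le> length (W S)"
    using many_corridors[OF assms] by blast
  have "{i. i < Q \<and> i div 2 \<notin> {}} = {..<Q}" by auto
  then have "walk (W {})" "(\<Sum>i<Q. l i) \<le> length (W {})" using W by metis+
  then have "?n * (?n - 1) \<le> 3 * length (W {}) + 12 * ?n"
    using l by (meson add_le_mono1 le_trans mult_le_mono2)
  then have "real (?n * (?n - 1)) \<le> real (3 * length (W {}) + 12 * ?n)" by (rule of_nat_mono)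
  then have "real ?n * (real ?n - 1) \<le> 3 * real (length (W {})) + 12 * real ?n"
    using assms by (simp add: of_nat_diff)
  \<comment> \<open>The loss is \<open>n / 3 + 4 * n\<close> for \<open>n = card A\<close>, rounded
    up to \<open>5 * n\<close>.\<close>
  then have "1 / 3 * (real ?n)\<^sup>2 - 5 * real ?n \<le> real (length (W {}))"
    by (simp add: algebra_simps power2_eq_square)
  then show ?thesis using \<open>walk (W {})\<close> by blast
qed

text \<open>Of a set of skipped pairs and its complement, at least one leaves a walk of half the total length.\<close>

lemma many_walks:
  assumes "30 \<le> card A"
  shows "2 powr (real (card A) / 30) \<le> real (card {P. walk P \<and> (real (card A))\<^sup>2 / 12 \<le> real (length P)})"
proof -
  let ?n = "card A"
  have n0: "0 < ?n" using assms by simp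
  obtain Q :: nat and W l where Q: "?n \<le> 3 * Q + 3" and l: "?n * (?n - 1) \<le> 3 * (\<Sum>i<Q. l i) + 12 * ?n"
    and W: "\<And>S. walk (W S)" "\<And>S. (\<Sum>i\<in>{i. i < Q \<and> i div 2 \<notin> S}. l i) \<le> length (W S)"
      "inj_on W (Pow {..<Q div 2})"
    using many_corridors[OF n0] by blast
  define U where "U = {..<Q div 2}"
  define G where "G = {S \<in> Pow U. (\<Sum>i<Q. l i) \<le> 2 * length (W S)}"
  have fU: "finite U" and cU: "card U = Q div 2" unfolding U_def by simp_all
  then have fP: "finite (Pow U)" "card (Pow U) = 2 ^ (Q div 2)" by (simp_all add: card_Pow)
  have GP: "G \<subseteq> Pow U" unfolding G_def by auto
  then have fG: "finite G" using fP finite_subset by blast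
  have "U - S \<in> G" if S: "S \<in> Pow U - G" for S
  proof -
    let ?X = "\<lambda>S. {i. i < Q \<and> i div 2 \<notin> S}"
    have "?X S \<union> ?X (U - S) = {..<Q}" by auto
    then have "(\<Sum>i<Q. l i) \<le> sum l (?X S) + sum l (?X (U - S))"
      using sum.union_inter[of "?X S" "?X (U - S)" l] by auto
    also have "\<dots> \<le> length (W S) + length (W (U - S))" using W(2) add_mono by blast
    finally show ?thesis using S unfolding G_def by auto
  qed
  then have "(\<lambda>S. U - S) ` (Pow U - G) \<subseteq> G" by blast
  moreover have "inj_on (\<lambda>S. U - S) (Pow U - G)" by (auto simp: inj_on_def)
  ultimately have "card (Pow U - G) \<le> card G" using card_inj_on_le fG by blast
  moreover have "card (Pow U - G) = card (Pow U) - card G" using card_Diff_subset[OF fG GP] .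
  ultimately have cG: "2 ^ (Q div 2) \<le> 2 * card G" using fP(2) by linarith
  let ?P = "{P. walk P \<and> (real ?n)\<^sup>2 / 12 \<le> real (length P)}"
  have "?P \<subseteq> {P. set P \<subseteq> Pow A \<and> distinct P}" unfolding walk_def cut_def by auto
  then have fin_P: "finite ?P" using finite_subset_distinct[of "Pow A"] fin finite_subset by blast
  have "W S \<in> ?P" if "S \<in> G" for S
  proof -
    have "?n * (?n - 1) \<le> 6 * length (W S) + 12 * ?n" using that l unfolding G_def by auto
    then have "real (?n * (?n - 1)) \<le> real (6 * length (W S) + 12 * ?n)" by (rule of_nat_mono)
    then have "real ?n * real ?n \<le> 6 * real (length (W S)) + 13 * real ?n"
      using assms by (simp add: of_nat_diff algebra_simps)
    \<comment> \<open>Now \<open>13 * n\<close> is at most half of the square of \<open>n\<close>;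
      the other half, divided by 6, gives the factor 1/12.\<close>
    moreover have "26 * real ?n \<le> real ?n * real ?n" using assms by (intro mult_right_mono) auto
    ultimately show ?thesis using W(1) by (simp add: power2_eq_square)
  qed
  then have "W ` G \<subseteq> ?P" by blast
  then have "card (W ` G) \<le> card ?P" by (rule card_mono[OF fin_P])
  moreover have "card (W ` G) = card G"
    using W(3) GP unfolding U_def by (intro card_image) (rule inj_on_subset)
  ultimately have "card G \<le> card ?P" by simp
  then have "2 ^ (Q div 2) \<le> 2 * card ?P" using cG by linarith
  then have "real (2 ^ (Q div 2)) \<le> real (2 * card ?P)" by (rule of_nat_mono)
  then have "2 powr real (Q div 2) \<le> 2 * real (card ?P)" by (simp add: powr_realpow)
  \<comment> \<open>There are at least \<open>n / 6 - 1\<close> pairs. The subtracted 1 pays for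
    keeping only half of the index sets.\<close>
  moreover have "real ?n / 30 \<le> real (Q div 2) - 1"
  proof -
    have "?n \<le> 6 * (Q div 2) + 6" using Q by presburger
    then show ?thesis using assms by simp
  qed
  then have "2 powr (real ?n / 30) \<le> 2 powr (real (Q div 2) - 1)" by simp
  moreover have "2 powr (real (Q div 2) - 1) = 2 powr real (Q div 2) / 2" by (simp add: powr_diff)
  ultimately show ?thesis by linarith
qed

end

subsection \<open>Faces in the plane\<close>

text \<open>By the intermediate value theorem, \<open>v - u\<close> keeps its sign on a connected
  set where it has no zero.\<close>

lemma connected_less:
  fixes u v :: "'a :: topological_space \<Rightarrow> real"
  assumes S: "connected S" and "continuous_on S u" "continuous_on S v"
    and ne: "\<And>x. x \<in> S \<Longrightarrow> u x \<noteq> v x" and a: "a \<in> S" "u a < v a" and b: "b \<in> S"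
  shows "u b < v b"
proof (rule ccontr)
  assume "\<not> u b < v b"
  moreover have "connected ((\<lambda>x. v x - u x) ` S)"
    using assms(2,3) by (intro connected_continuous_image[OF _ S] continuous_intros)
  ultimately have "0 \<in> (\<lambda>x. v x - u x) ` S"
    using a b connectedD_interval[of "(\<lambda>x. v x - u x) ` S" "v b - u b" "v a - u a" 0] by auto
  then show False using ne by force
qed

lemma between_finite_sets:
  fixes X Y :: "real set"
  assumes "finite X" "finite Y" "\<And>x y. x \<in> X \<Longrightarrow> y \<in> Y \<Longrightarrow> x < y"
  obtains t where "\<And>x. x \<in> X \<Longrightarrow> x < t" "\<And>y. y \<in> Y \<Longrightarrow> t < y"
proof -
  obtain B where B: "\<forall>x\<in>X \<union> Y. \<bar>x\<bar> \<le> B"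
    using finite_imp_bounded[of "X \<union> Y"] assms(1,2) unfolding bounded_real by auto
  \<comment> \<open>The added outer points make \<open>Max\<close> and \<open>Min\<close> meaningful
    even if \<open>X\<close> or \<open>Y\<close> is empty.\<close>
  let ?X = "insert (- \<bar>B\<bar> - 1) X" and ?Y = "insert (\<bar>B\<bar> + 1) Y"
  have b: "- \<bar>B\<bar> \<le> z \<and> z \<le> \<bar>B\<bar>" if "z \<in> X \<union> Y" for z
    using bspec[OF B that] by linarith
  have "x < y" if xy: "x \<in> ?X" "y \<in> ?Y" for x y
    using xy b[of x] b[of y] assms(3)[of x y] by auto
  moreover have "Max ?X \<in> ?X" "Min ?Y \<in> ?Y" using assms(1,2) by (simp_all only: Max_in Min_in finite_insert insert_not_empty not_False_eq_True)
  ultimately have "Max ?X < Min ?Y" by blast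
  then obtain t where "Max ?X < t" "t < Min ?Y" using dense by blast
  then show ?thesis using that[of t] assms(1,2) by simp
qed

text \<open>The change of sides in \<open>cross_at\<close> is local. As the common point is unique,
  the order found at distance \<open>e/2\<close> on either side of \<open>c\<close> spreads over the
  whole open half-line.\<close>

lemma simple_arrangement_pseudolines:
  assumes "simple_arrangement A"
  shows "pseudolines A (\<lambda>f. f)"
proof
  have pl: "pseudoline_arrangement A" using assms unfolding simple_arrangement_def by blast
  then show "finite A" unfolding pseudoline_arrangement_def by blast
  show cont: "continuous_on UNIV f" if "f \<in> A" for f
    using pl that unfolding pseudoline_arrangement_def by blast
  show "\<exists>c. f c = g c \<and> ((\<forall>x<c. f x < g x) \<and> (\<forall>x>c. g x < f x) \<or>
       (\<forall>x<c. g x < f x) \<and> (\<forall>x>c. f x < g x))" if fg: "f \<in> A" "g \<in> A" "f \<noteq> g" for f g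
  proof -
    have "cross_exactly_once f g" using pl fg unfolding pseudoline_arrangement_def by blast
    then obtain c where uniq: "\<And>x y. f x = g x \<Longrightarrow> f y = g y \<Longrightarrow> x = y" and c: "cross_at f g c"
      unfolding cross_exactly_once_def by blast
    then have eq: "f c = g c" unfolding cross_at_def by blast
    have ne: "f x \<noteq> g x" "g x \<noteq> f x" if "x \<noteq> c" for x using uniq[OF _ eq, of x] that by auto
    obtain e where e: "e > 0" "\<And>d. 0 < d \<Longrightarrow> d < e \<Longrightarrow> (f (c - d) < g (c - d) \<and> g (c + d) < f (c + d)) \<or>
        (g (c - d) < f (c - d) \<and> f (c + d) < g (c + d))"
      using c unfolding cross_at_def by blast
    have "0 < e / 2" "e / 2 < e" using e(1) by simp_all
    from e(2)[OF this] have side: "(f (c - e/2) < g (c - e/2) \<and> g (c + e/2) < f (c + e/2)) \<or>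
        (g (c - e/2) < f (c - e/2) \<and> f (c + e/2) < g (c + e/2))" .
    have co: "continuous_on S f" "continuous_on S g" for S
      using cont fg continuous_on_subset by blast+
    have left: "u x < v x" if "u (c - e/2) < v (c - e/2)" "x < c" "{u, v} = {f, g}" for u v x
      using that ne e(1) co by (intro connected_less[of "{..<c}" u v "c - e/2" x]) (auto simp: doubleton_eq_iff)
    have right: "u x < v x" if "u (c + e/2) < v (c + e/2)" "c < x" "{u, v} = {f, g}" for u v x
      using that ne e(1) co by (intro connected_less[of "{c<..}" u v "c + e/2" x]) (auto simp: doubleton_eq_iff)
    have "(\<forall>x<c. f x < g x) \<and> (\<forall>x>c. g x < f x)"
      if "f (c - e/2) < g (c - e/2)" "g (c + e/2) < f (c + e/2)"
      using left[of f g] right[of g f] that by (simp add: insert_commute)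
    moreover have "(\<forall>x<c. g x < f x) \<and> (\<forall>x>c. f x < g x)"
      if "g (c - e/2) < f (c - e/2)" "f (c + e/2) < g (c + e/2)"
      using left[of g f] right[of f g] that by (simp add: insert_commute)
    ultimately show ?thesis using side eq by blast
  qed
  show "\<not> (f x = g x \<and> g x = l x)"
    if "f \<in> A" "g \<in> A" "l \<in> A" "f \<noteq> g" "f \<noteq> l" "g \<noteq> l" for f g l x
  proof
    assume "f x = g x \<and> g x = l x"
    then have "(x, f x) \<in> curve f \<inter> curve g \<inter> curve l" unfolding curve_def by auto
    then show False using assms that unfolding simple_arrangement_def by blast
  qed
qed

section \<open>Faces as regions between pseudolines\<close>

locale arrangement = pseudolines A "\<lambda>f. f" for A :: "(real \<Rightarrow> real) set"
begin

definition region :: "(real \<Rightarrow> real) set \<Rightarrow> (real \<times> real) set" where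
  "region D = {p. (\<forall>f\<in>D. f (fst p) < snd p) \<and> (\<forall>f\<in>A - D. snd p < f (fst p))}"

lemma continuous_on_curve: "f \<in> A \<Longrightarrow> continuous_on S (\<lambda>p. f (fst p))" for S :: "(real \<times> real) set"
  by (rule continuous_on_compose2[OF cont continuous_on_fst[OF continuous_on_id]]) auto

lemma region_eq:
  assumes "D \<subseteq> A" "p \<in> region D"
  shows "D = {f\<in>A. f (fst p) < snd p}"
proof -
  have r: "\<And>f. f \<in> D \<Longrightarrow> f (fst p) < snd p" "\<And>f. f \<in> A - D \<Longrightarrow> snd p < f (fst p)"
    using assms(2) unfolding region_def by blast+
  have "f \<in> D" if "f \<in> A" "f (fst p) < snd p" for f
    using r(2)[of f] that by fastforce
  then show ?thesis using r(1) assms(1) by blast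
qed

lemma open_region: "D \<subseteq> A \<Longrightarrow> open (region D)"
proof -
  assume D: "D \<subseteq> A"
  have "region D = (\<Inter>f\<in>D. {p. f (fst p) < snd p}) \<inter> (\<Inter>f\<in>A - D. {p. snd p < f (fst p)})"
    unfolding region_def by auto
  moreover have "finite D" "finite (A - D)" using D fin finite_subset by blast+
  moreover have "open {p. f (fst p) < snd p}" "open {p. snd p < f (fst p)}" if "f \<in> A" for f
    by (intro open_Collect_less continuous_on_curve[OF that] continuous_on_snd continuous_on_id)+
  ultimately show ?thesis using D by (auto intro!: open_Int open_INT)
qed

text \<open>Over \<open>x\<close> the region is the open interval between the pseudolines of
  \<open>D\<close> and the others; it is non-empty exactly if the former all lie below the
  latter.\<close>

lemma fst_region:
  assumes D: "D \<subseteq> A"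
  shows "fst ` region D = {x. cut x D}"
proof (intro set_eqI iffI)
  fix x assume "x \<in> fst ` region D"
  then show "x \<in> {x. cut x D}" using D unfolding region_def cut_def by (auto intro: less_trans)
next
  fix x assume "x \<in> {x. cut x D}"
  then have c: "\<And>f g. f \<in> D \<Longrightarrow> g \<in> A - D \<Longrightarrow> f x < g x" unfolding cut_def by blast
  have fins: "finite D" "finite (A - D)" using D fin finite_subset by blast+
  obtain t where "\<And>y. y \<in> (\<lambda>f. f x) ` D \<Longrightarrow> y < t" "\<And>y. y \<in> (\<lambda>f. f x) ` (A - D) \<Longrightarrow> t < y"
    by (rule between_finite_sets[of "(\<lambda>f. f x) ` D" "(\<lambda>f. f x) ` (A - D)"]) (use c fins in auto)
  then have "(x, t) \<in> region D" unfolding region_def by auto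
  then show "x \<in> fst ` region D" by force
qed

text \<open>\<open>fst\<close> maps the region openly onto an interval, with intervals as fibres, so
  connectedness lifts from the base.\<close>

lemma connected_region:
  assumes D: "D \<subseteq> A"
  shows "connected (region D)"
proof -
  have "is_interval {x. cut x D}" unfolding is_interval_1 using cut_between by blast
  then have I: "connected {x. cut x D}" by (simp add: is_interval_connected_1)
  have "connected (region D \<inter> fst -` {x. cut x D})"
  proof (rule connected_open_monotone_preimage[OF _ fst_region[OF D] _ _ I order_refl])
    show "continuous_on (region D) fst" by (intro continuous_intros)
    show "openin (top_of_set {x. cut x D}) (fst ` C)" if "openin (top_of_set (region D)) C" for C
    proof -
      have "open C" "C \<subseteq> region D" using that openin_open_eq[OF open_region[OF D]] by auto
      then have "open (fst ` C)" "fst ` C \<subseteq> {x. cut x D}" using open_image_fst fst_region[OF D] by blast+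
      then show ?thesis by (rule open_subset[rotated])
    qed
    show "connected (region D \<inter> fst -` {x})" for x
    proof -
      have "is_interval {t. (x, t) \<in> region D}"
        unfolding is_interval_1 region_def by (auto intro: le_less_trans less_le_trans)
      then have "connected (Pair x ` {t. (x, t) \<in> region D})"
        by (intro connected_continuous_image continuous_intros) (simp add: is_interval_connected_1)
      moreover have "region D \<inter> fst -` {x} = Pair x ` {t. (x, t) \<in> region D}" by auto
      ultimately show ?thesis by simp
    qed
  qed
  moreover have "region D \<subseteq> fst -` {x. cut x D}" using fst_region[OF D] by blast
  ultimately show ?thesis by (simp add: inf.absorb1)
qed

text \<open>Maximality: a connected set that misses all curves stays on one side of each of
  them.\<close>

lemma region_face:
  assumes "D \<subseteq> A" "region D \<noteq> {}"
  shows "region D \<in> faces A"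
  unfolding faces_def in_components_maximal
proof (intro conjI allI impI)
  let ?U = "- (\<Union>f\<in>A. curve f)"
  have U: "p \<in> ?U \<longleftrightarrow> (\<forall>f\<in>A. f (fst p) \<noteq> snd p)" for p unfolding curve_def by (cases p) auto
  show "region D \<noteq> {}" by fact
  show "region D \<subseteq> ?U"
  proof
    fix p assume "p \<in> region D"
    then have "f (fst p) < snd p \<or> snd p < f (fst p)" if "f \<in> A" for f
      using that unfolding region_def by blast
    then show "p \<in> ?U" unfolding U by force
  qed
  show "connected (region D)" by (rule connected_region[OF assms(1)])
  fix E assume E: "E \<noteq> {} \<and> region D \<subseteq> E \<and> E \<subseteq> ?U \<and> connected E"
  obtain q where q: "q \<in> region D" using assms(2) by blast
  have "p \<in> region D" if p: "p \<in> E" for p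
  proof -
    have ne: "f (fst z) \<noteq> snd z" if "f \<in> A" "z \<in> E" for f z using E U that by blast
    have qE: "q \<in> E" using q E by blast
    have "f (fst p) < snd p" if f: "f \<in> D" for f
    proof (rule connected_less[of E "\<lambda>z. f (fst z)" snd q p])
      show "f (fst q) < snd q" using q f unfolding region_def by blast
    qed (use E ne f assms(1) qE p in \<open>auto intro: continuous_on_curve continuous_intros\<close>)
    moreover have "snd p < f (fst p)" if f: "f \<in> A - D" for f
    proof (rule connected_less[of E snd "\<lambda>z. f (fst z)" q p])
      show "snd q < f (fst q)" using q f unfolding region_def by blast
      show "snd z \<noteq> f (fst z)" if "z \<in> E" for z using ne[of f z] f that by auto
    qed (use E f qE p in \<open>auto intro: continuous_on_curve continuous_intros\<close>)
    ultimately show ?thesis unfolding region_def by blast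
  qed
  then show "E = region D" using E by blast
qed

text \<open>A point off the curves lies in the region of the pseudolines below it, so the subsets of
  \<open>A\<close> account for all faces.\<close>

lemma finite_faces: "finite (faces A)"
proof -
  have "F \<in> region ` Pow A" if F: "F \<in> faces A" for F
  proof -
    obtain p where p: "p \<in> F" using F in_components_nonempty unfolding faces_def by blast
    have "F \<subseteq> - (\<Union>f\<in>A. curve f)" using F in_components_subset unfolding faces_def by blast
    then have ne: "f (fst p) \<noteq> snd p" if "f \<in> A" for f using p that unfolding curve_def by (cases p) auto
    let ?D = "{f\<in>A. f (fst p) < snd p}"
    have r: "p \<in> region ?D" unfolding region_def using ne by force
    then have "region ?D \<in> faces A" by (intro region_face) auto
    then have "F = region ?D" using F r p components_nonoverlap unfolding faces_def by blast
    then show ?thesis by blast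
  qed
  then have "faces A \<subseteq> region ` Pow A" by blast
  then show ?thesis using fin by (meson finite_Pow_iff finite_imageI finite_subset)
qed

text \<open>\<open>E\<close> is \<open>D\<close> with one more pseudoline \<open>f\<close>. The
  shared edge is the piece \<open>e\<close> of \<open>f\<close> through \<open>(x, f x)\<close>: all
  along it \<open>D\<close> stays below and \<open>A - E\<close> above, so points just under it are
  in \<open>region D\<close> and points just over it in \<open>region E\<close>.\<close>

lemma share_edge_insert:
  assumes D: "cut x D" and E: "cut x E" and c: "card E = Suc (card D)"
  shows "share_edge A (region D) (region E)"
proof -
  have sub: "D \<subseteq> A" "E \<subseteq> A" "D \<subseteq> E" using cut_mono[OF D E] c D E unfolding cut_def by auto
  then have "card (E - D) = 1" using c card_Diff_subset[OF finite_cut[OF D]] by simp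
  then obtain f where "E - D = {f}" by (auto simp: card_1_singleton_iff)
  then have f: "E = insert f D" "f \<notin> D" "f \<in> A" using sub by auto
  have below: "g x < f x" if "g \<in> D" for g using D f that unfolding cut_def by blast
  have above: "f x < g x" if "g \<in> A - E" for g using E f that unfolding cut_def by blast
  let ?S = "curve f - vertices A" and ?p = "(x, f x)"
  define e where "e = connected_component_set ?S ?p"
  \<comment> \<open>Another pseudoline meets \<open>curve f\<close> only in vertices, which are
    removed from \<open>?S\<close>.\<close>
  have off: "z \<in> ?S \<Longrightarrow> g \<in> A \<Longrightarrow> g \<noteq> f \<Longrightarrow> g (fst z) \<noteq> snd z" for z g
    using f(3) unfolding vertices_def curve_def by (cases z) force
  have "?p \<notin> vertices A"
  proof
    assume "?p \<in> vertices A"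
    then obtain g g' where g: "g \<in> A" "g' \<in> A" "g \<noteq> g'" "g x = f x" "g' x = f x"
      unfolding vertices_def curve_def by auto
    have "u = f" if "u \<in> A" "u x = f x" for u
      using below[of u] above[of u] that f(1) by fastforce
    then show False using g by blast
  qed
  then have p: "?p \<in> ?S" unfolding curve_def by auto
  then have pe: "?p \<in> e" unfolding e_def by simp
  have eS: "e \<subseteq> ?S" "connected e" unfolding e_def by (simp_all add: connected_component_subset)
  have snd_e: "snd z = f (fst z)" if "z \<in> e" for z using that eS(1) unfolding curve_def by auto
  have e_below: "g (fst z) < f (fst z)" if z: "z \<in> e" and g: "g \<in> D" for z g
  proof -
    have "g \<in> A" "g \<noteq> f" using g sub f by auto
    then have "g (fst z) < snd z"
      using off eS below[OF g] pe z
      by (intro connected_less[of e "\<lambda>z. g (fst z)" snd ?p z]) (auto intro: continuous_on_curve continuous_intros)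
    then show ?thesis using snd_e[OF z] by simp
  qed
  have e_above: "f (fst z) < g (fst z)" if z: "z \<in> e" and g: "g \<in> A - E" for z g
  proof -
    have "g \<in> A" "g \<noteq> f" using g f by auto
    then have "snd z < g (fst z)"
      using off[of _ g] eS above[OF g] pe z
      by (intro connected_less[of e snd "\<lambda>z. g (fst z)" ?p z]) (auto intro: continuous_on_curve continuous_intros dest: sym)
    then show ?thesis using snd_e[OF z] by simp
  qed
  have fins: "finite D" "finite (A - E)" using finite_cut[OF D] fin by auto
  have "z \<in> frontier (region D)" if z: "z \<in> e" for z
  proof -
    let ?a = "fst z"
    have "z \<notin> region D" using snd_e[OF z] f unfolding region_def by auto
    moreover have "z \<in> closure (region D)"
      unfolding closure_approachable
    proof (intro allI impI)
      fix d :: real assume d: "d > 0"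
      \<comment> \<open>A point straight below \<open>z\<close>, nearer than \<open>d\<close> and
        above all pseudolines of \<open>D\<close>.\<close>
      obtain t where t: "\<And>y. y \<in> insert (f ?a - d) ((\<lambda>g. g ?a) ` D) \<Longrightarrow> y < t" "\<And>y. y \<in> {f ?a} \<Longrightarrow> t < y"
        by (rule between_finite_sets[of "insert (f ?a - d) ((\<lambda>g. g ?a) ` D)" "{f ?a}"])
          (use d fins e_below[OF z] in auto)
      have "t < g ?a" if "g \<in> A - D" for g
        using that f(1) t(2) e_above[OF z, of g] by (cases "g = f") (auto intro: less_trans)
      then have "(?a, t) \<in> region D" using t unfolding region_def by auto
      moreover have "dist (?a, t) z < d"
        using t(1)[of "f ?a - d"] t(2)[of "f ?a"] snd_e[OF z]
        by (cases z) (auto simp: dist_Pair_Pair dist_real_def)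
      ultimately show "\<exists>y\<in>region D. dist y z < d" by blast
    qed
    ultimately show ?thesis unfolding frontier_def interior_open[OF open_region[OF sub(1)]] by blast
  qed
  moreover have "z \<in> frontier (region E)" if z: "z \<in> e" for z
  proof -
    let ?a = "fst z"
    have "z \<notin> region E" using snd_e[OF z] f unfolding region_def by auto
    moreover have "z \<in> closure (region E)"
      unfolding closure_approachable
    proof (intro allI impI)
      fix d :: real assume d: "d > 0"
      obtain t where t: "\<And>y. y \<in> {f ?a} \<Longrightarrow> y < t" "\<And>y. y \<in> insert (f ?a + d) ((\<lambda>g. g ?a) ` (A - E)) \<Longrightarrow> t < y"
        by (rule between_finite_sets[of "{f ?a}" "insert (f ?a + d) ((\<lambda>g. g ?a) ` (A - E))"])
          (use d fins e_above[OF z] in auto)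
      have "g ?a < t" if "g \<in> E" for g
        using that f(1) t(1) e_below[OF z, of g] by (cases "g = f") (auto intro: less_trans)
      then have "(?a, t) \<in> region E" using t unfolding region_def by auto
      moreover have "dist (?a, t) z < d"
        using t(1)[of "f ?a"] t(2)[of "f ?a + d"] snd_e[OF z]
        by (cases z) (auto simp: dist_Pair_Pair dist_real_def)
      ultimately show "\<exists>y\<in>region E. dist y z < d" by blast
    qed
    ultimately show ?thesis unfolding frontier_def interior_open[OF open_region[OF sub(2)]] by blast
  qed
  moreover have "e \<in> edges A" using f(3) p unfolding edges_def e_def by (auto intro: componentsI)
  ultimately show ?thesis unfolding share_edge_def by blast
qed

lemma share_edge_sym: "share_edge A F G \<Longrightarrow> share_edge A G F"
  unfolding share_edge_def by blast

lemma adj_share_edge: "adj D E \<Longrightarrow> share_edge A (region D) (region E)"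
  unfolding adj_def by (metis share_edge_insert share_edge_sym)

lemma cut_region:
  assumes "cut x D"
  shows "D \<subseteq> A \<and> region D \<noteq> {}"
proof
  show D: "D \<subseteq> A" using assms unfolding cut_def by simp
  have "x \<in> fst ` region D" unfolding fst_region[OF D] using assms by simp
  then show "region D \<noteq> {}" by auto
qed

lemma inj_on_region: "inj_on region {D. \<exists>x. cut x D}"
proof (rule inj_onI)
  fix D E assume *: "D \<in> {D. \<exists>x. cut x D}" "E \<in> {D. \<exists>x. cut x D}" "region D = region E"
  then have "region D \<noteq> {}" "D \<subseteq> A" "E \<subseteq> A" using cut_region by auto
  then obtain p where "p \<in> region D" "p \<in> region E" "D \<subseteq> A" "E \<subseteq> A" using *(3) by auto
  then show "D = E" using region_eq[of D p] region_eq[of E p] by simp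
qed

lemma walk_dual_path:
  assumes "walk P" "P \<noteq> []"
  shows "dual_path A (map region P)"
proof -
  have cuts: "set P \<subseteq> {D. \<exists>x. cut x D}" using assms(1) unfolding walk_def by blast
  have "set (map region P) \<subseteq> faces A" using cuts cut_region region_face by auto
  moreover have "distinct (map region P)"
    using assms(1) inj_on_subset[OF inj_on_region cuts] unfolding walk_def by (simp add: distinct_map)
  moreover have "share_edge A (map region P ! i) (map region P ! Suc i)" if "Suc i < length P" for i
    using assms(1) that adj_share_edge unfolding walk_def by (auto simp: successively_conv_nth)
  ultimately show ?thesis using assms(2) unfolding dual_path_def by simp
qed

end

section \<open>From walks to dual paths\<close>

lemma (in arrangement) face_singleton: "F \<in> faces A \<Longrightarrow> dual_path A [F]"
  unfolding dual_path_def by simp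

text \<open>Since \<open>card\<close> is 0 on infinite sets, lower bounds on the number of dual
  paths rest on this finiteness.\<close>

lemma (in arrangement) finite_dual_paths: "finite {P. dual_path A P \<and> Q P}"
proof -
  have "{P. dual_path A P \<and> Q P} \<subseteq> {P. set P \<subseteq> faces A \<and> distinct P}"
    unfolding dual_path_def by blast
  then show ?thesis using finite_subset_distinct[OF finite_faces] finite_subset by blast
qed

lemma (in arrangement) extreme_faces: "region {} \<in> faces A" "region A \<in> faces A"
proof -
  have "cut 0 {}" "cut 0 A" unfolding cut_def by auto
  then show "region {} \<in> faces A" "region A \<in> faces A" using cut_region region_face by blast+
qed

lemma (in arrangement) long_dual_path:
  "\<exists>P. dual_path A P \<and> 1 / 3 * (real (card A))\<^sup>2 - 5 * real (card A) \<le> real (length P)"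
proof (cases "card A = 0")
  case True
  then show ?thesis using face_singleton[OF extreme_faces(1)] by (intro exI[of _ "[region {}]"]) simp
next
  case False
  then obtain P where P: "walk P" "1 / 3 * (real (card A))\<^sup>2 - 5 * real (card A) \<le> real (length P)"
    using long_walk by blast
  show ?thesis
  proof (cases "P = []")
    case True
    then show ?thesis using P(2) face_singleton[OF extreme_faces(1)] by (intro exI[of _ "[region {}]"]) simp
  next
    case False
    then show ?thesis using P walk_dual_path[of P] by (intro exI[of _ "map region P"]) simp
  qed
qed

text \<open>The constants make small cases trivial: below 30 pseudolines the required length is less
  than 1 and the required number at most 2, which the bottom and top faces supply as one-element
  paths. From 30 on \<open>many_walks\<close> applies.\<close>

lemma (in arrangement) many_dual_paths:
  "2 powr (1 / 30 * real (card A)) \<le>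
    real (card {P. dual_path A P \<and> 1 / 900 * (real (card A))\<^sup>2 \<le> real (length P)})"
    (is "_ \<le> real (card ?X)")
proof -
  let ?n = "card A"
  have fin_X: "finite ?X" by (rule finite_dual_paths)
  consider "?n = 0" | "0 < ?n" "?n < 30" | "30 \<le> ?n" by linarith
  then show ?thesis
  proof cases
    case 1
    then have "{[region {}]} \<subseteq> ?X" using face_singleton[OF extreme_faces(1)] by simp
    then have "card {[region {}]} \<le> card ?X" by (rule card_mono[OF fin_X])
    then show ?thesis using 1 by simp
  next
    case 2
    have "(real ?n)\<^sup>2 \<le> 30\<^sup>2" using 2 by (intro power_mono) auto
    then have "{[region {}], [region A]} \<subseteq> ?X"
      using face_singleton extreme_faces by simp
    then have "card {[region {}], [region A]} \<le> card ?X" by (rule card_mono[OF fin_X])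
    moreover have "region {} \<noteq> region A"
    proof
      assume "region {} = region A"
      moreover obtain p where "p \<in> region A" using cut_region[of 0 A] unfolding cut_def by blast
      ultimately have "{} = A" using region_eq[of "{}" p] region_eq[of A p] by blast
      then show False using 2(1) by simp
    qed
    then have "card {[region {}], [region A]} = 2" by simp
    ultimately have "2 \<le> card ?X" by simp
    moreover have "2 powr (1 / 30 * real ?n) \<le> 2 powr 1" using 2 by (intro powr_mono) auto
    ultimately show ?thesis by simp
  next
    case 3
    let ?W = "{P. walk P \<and> (real ?n)\<^sup>2 / 12 \<le> real (length P)}"
    have "map region ` ?W \<subseteq> ?X"
    proof (rule image_subsetI)
      fix P assume P: "P \<in> ?W"
      have "0 < (real ?n)\<^sup>2" using 3 by simp
      then have "P \<noteq> []" "1 / 900 * (real ?n)\<^sup>2 \<le> real (length P)" using P by (auto simp: not_le)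
      then show "map region P \<in> ?X" using P walk_dual_path by simp
    qed
    moreover have "inj_on (map region) ?W"
      using inj_on_region unfolding walk_def by (intro inj_on_mapI inj_on_subset[OF inj_on_region]) auto
    ultimately have "card ?W \<le> card ?X" using card_inj_on_le fin_X by blast
    moreover have "2 powr (1 / 30 * real ?n) \<le> real (card ?W)" using many_walks[OF 3] by simp
    ultimately show ?thesis by linarith
  qed
qed

theorem theorem1:
  "(\<exists>C::real. C > 0 \<and>
      (\<forall>n::nat. n \<ge> 1 \<longrightarrow>
        (\<forall>A. simple_arrangement A \<and> card A = n \<longrightarrow>
          (\<exists>P. dual_path A P \<and> real (length P) \<ge> 1 / 3 * (real n)\<^sup>2 - C * real n)))) \<and>
   (\<exists>c\<^sub>1 c\<^sub>2 :: real. c\<^sub>1 > 0 \<and> c\<^sub>2 > 0 \<and>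
      (\<forall>n::nat. \<forall>A. simple_arrangement A \<and> card A = n \<longrightarrow>
        real (card {P. dual_path A P \<and> real (length P) \<ge> c\<^sub>2 * (real n)\<^sup>2})
          \<ge> 2 powr (c\<^sub>1 * real n)))"
proof
  have arr: "arrangement A" if "simple_arrangement A" for A
    unfolding arrangement_def using that by (rule simple_arrangement_pseudolines)
  show "\<exists>C::real. C > 0 \<and> (\<forall>n::nat. n \<ge> 1 \<longrightarrow> (\<forall>A. simple_arrangement A \<and> card A = n \<longrightarrow>
          (\<exists>P. dual_path A P \<and> real (length P) \<ge> 1 / 3 * (real n)\<^sup>2 - C * real n)))"
    using arrangement.long_dual_path[OF arr] by (intro exI[of _ 5]) auto
  show "\<exists>c\<^sub>1 c\<^sub>2 :: real. c\<^sub>1 > 0 \<and> c\<^sub>2 > 0 \<and>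
      (\<forall>n::nat. \<forall>A. simple_arrangement A \<and> card A = n \<longrightarrow>
        real (card {P. dual_path A P \<and> real (length P) \<ge> c\<^sub>2 * (real n)\<^sup>2}) \<ge> 2 powr (c\<^sub>1 * real n))"
    using arrangement.many_dual_paths[OF arr] by (intro exI[of _ "1/30"] exI[of _ "1/900"]) auto
qed

end
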